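(* Let $\nu>0$ and $0<R_1<R_2$. There exists a constant $C_1(\nu,R_1,R_2)>0$, depending only on $\nu,R_1,R_2$, such that the following holds. Let $\omega_1,\omega_2\in\mathbb{R}$ and let $(v,p)$, $v=v^r\bm{e}_r+v^\theta\bm{e}_\theta+v^z\bm{e}_z$, be an axially symmetric smooth solution (that is, $v^r,v^\theta,v^z,p$ are functions of $(r,z)$ only, smooth up to the boundary) of the stationary Navier--Stokes equations $$\left\{\begin{aligned} (v^r\partial_r+v^z\partial_z)v^r-\frac{(v^\theta)^2}{r}+\partial_r p&=\nu\Big(\partial_r^2+\frac1r\partial_r+\partial_z^2-\frac1{r^2}\Big)v^r,\\ (v^r\partial_r+v^z\partial_z)v^\theta+\frac{v^rv^\theta}{r}&=\nu\Big(\partial_r^2+\frac1r\partial_r+\partial_z^2-\frac1{r^2}\Big)v^\theta,\\ (v^r\partial_r+v^z\partial_z)v^z+\partial_z p&=\nu\Big(\partial_r^2+\frac1r\partial_r+\partial_z^2\Big)v^z,\\ \frac1r\partial_r(rv^r)+\partial_z v^z&=0 \end{aligned}\right.$$ for $r\in(R_1,R_2)$, $z\in\mathbb{R}$, with the boundary conditions $$v^r(R_j,z)=v^z(R_j,z)=0\ (j=1,2),\qquad v^\theta(R_1,z)=R_1\omega_1,\qquad v^\theta(R_2,z)=R_2\omega_2$$ for all $z\in\mathbb{R}$. If $$\max\{R_1|\omega_1|,R_2|\omega_2|\}<C_1(\nu,R_1,R_2)\quad\text{and}\quad \|v\|_{L^\infty(\Omega)}<C_1(\nu,R_1,R_2),$$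 then there exist constants $a,b\in\mathbb{R}$ such that $$\begin{aligned} v^r&\equiv0,\\ v^\theta&=Ar+B\frac1r,\\ v^z&=\frac{a}{4\nu}R_1^2\left[\Big(\frac{r}{R_1}\Big)^2-1+\frac{1-\eta^2}{\eta^2\log\eta}\log\Big(\frac{r}{R_1}\Big)\right],\\ p&=az+b+\frac{A^2}{2}r^2+2AB\log r-\frac{B^2}{2}\frac1{r^2}, \end{aligned}$$ where $\eta$, $A$, $B$ are the constants defined in the context. In particular, if moreover the pressure $p$ is bounded or periodic in $z$, then $a=0$, hence $v^z\equiv0$, so that $v$ coincides with the canonical Taylor--Couette flow $v^r\equiv 0$, $v^\theta=Ar+B\frac1r$, $v^z\equiv0$.
   Context: $\Omega=\{(x_1,x_2,x_3)\in\mathbb{R}^3: R_1<\sqrt{x_1^2+x_2^2}<R_2\}$ is the region between two concentric cylinders. Cylindrical coordinates $(r,\theta,z)$ are used, with $\bm{e}_r=(\cos\theta,\sin\theta,0)$, $\bm{e}_\theta=(-\sin\theta,\cos\theta,0)$, $\bm{e}_z=(0,0,1)$. $\nu$ is the viscosity constant and $\omega_1,\omega_2$ are the angular velocities of the inner and outer cylinders. Constants: $\eta=R_1/R_2$ and, if $\omega_1\neq0$, $\mu=\omega_2/\omega_1$. Then $$A=\begin{cases}\dfrac{\mu-\eta^2}{1-\eta^2}\,\omega_1,&\omega_1\ne0,\\[2mm]\dfrac{1}{1-\eta^2}\,\omega_2,&\omega_1=0,\end{cases}\qquad B=\begin{cases}\dfrac{1-\mu}{1-\eta^2}\,\omega_1R_1^2,&\omega_1\ne0,\\[2mm]-\dfrac{1}{1-\eta^2}\,\omega_2R_1^2,&\omega_1=0.\end{cases}$$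 *)

theory Defs
  imports "HOL-Probability.Essential_Supremum"
begin

text \<open>Scalar functions of the cylindrical coordinates \<open>(r, z)\<close> have type
  \<open>real \<Rightarrow> real \<Rightarrow> real\<close>; only their values on the closed strip matter.\<close>

definition strip :: "real \<Rightarrow> real \<Rightarrow> (real \<times> real) set" where
  "strip R1 R2 = {R1..R2} \<times> UNIV"

text \<open>\<open>Ck_on k S f\<close>: \<open>f\<close> is \<open>k\<close> times continuously differentiable on \<open>S\<close>, derivatives being taken
  relative to \<open>S\<close>; \<open>f1\<close> and \<open>f2\<close> are the two partial derivatives. When \<open>S\<close> is a closed strip with
  nonempty interior (the only use below), these derivatives are unique, and the condition says that
  \<open>f\<close> is \<open>C^k\<close> in the interior with all partial derivatives of order at most \<open>k\<close> extending
  continuously to the boundary.\<close>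

primrec Ck_on :: "nat \<Rightarrow> (real \<times> real) set \<Rightarrow> (real \<times> real \<Rightarrow> real) \<Rightarrow> bool" where
  "Ck_on 0 S f \<longleftrightarrow> continuous_on S f"
| "Ck_on (Suc k) S f \<longleftrightarrow>
     (\<exists>f1 f2. (\<forall>x\<in>S. (f has_derivative (\<lambda>h. f1 x * fst h + f2 x * snd h)) (at x within S))
        \<and> Ck_on k S f1 \<and> Ck_on k S f2)"

definition smooth_upto_boundary :: "real \<Rightarrow> real \<Rightarrow> (real \<Rightarrow> real \<Rightarrow> real) \<Rightarrow> bool" where
  "smooth_upto_boundary R1 R2 f \<longleftrightarrow> (\<forall>k. Ck_on k (strip R1 R2) (\<lambda>(r, z). f r z))"

definition d_r :: "(real \<Rightarrow> real \<Rightarrow> real) \<Rightarrow> real \<Rightarrow> real \<Rightarrow> real" where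
  "d_r f r z = deriv (\<lambda>s. f s z) r"

definition d_z :: "(real \<Rightarrow> real \<Rightarrow> real) \<Rightarrow> real \<Rightarrow> real \<Rightarrow> real" where
  "d_z f r z = deriv (\<lambda>s. f r s) z"

definition laplace_cyl :: "(real \<Rightarrow> real \<Rightarrow> real) \<Rightarrow> real \<Rightarrow> real \<Rightarrow> real" where
  "laplace_cyl f r z = d_r (d_r f) r z + 1 / r * d_r f r z + d_z (d_z f) r z"

definition axisym_stationary_NS ::
  "real \<Rightarrow> real \<Rightarrow> real \<Rightarrow> (real \<Rightarrow> real \<Rightarrow> real) \<Rightarrow> (real \<Rightarrow> real \<Rightarrow> real) \<Rightarrow> (real \<Rightarrow> real \<Rightarrow> real)
    \<Rightarrow> (real \<Rightarrow> real \<Rightarrow> real) \<Rightarrow> bool" where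
  "axisym_stationary_NS \<nu> R1 R2 vr v\<theta> vz p \<longleftrightarrow>
    (\<forall>r\<in>{R1<..<R2}. \<forall>z.
       vr r z * d_r vr r z + vz r z * d_z vr r z - (v\<theta> r z)\<^sup>2 / r + d_r p r z
         = \<nu> * (laplace_cyl vr r z - 1 / r\<^sup>2 * vr r z)
     \<and> vr r z * d_r v\<theta> r z + vz r z * d_z v\<theta> r z + vr r z * v\<theta> r z / r
         = \<nu> * (laplace_cyl v\<theta> r z - 1 / r\<^sup>2 * v\<theta> r z)
     \<and> vr r z * d_r vz r z + vz r z * d_z vz r z + d_z p r z
         = \<nu> * laplace_cyl vz r z
     \<and> 1 / r * d_r (\<lambda>s \<zeta>. s * vr s \<zeta>) r z + d_z vz r z = 0)"

definition rotating_cylinder_bc ::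
  "real \<Rightarrow> real \<Rightarrow> real \<Rightarrow> real \<Rightarrow> (real \<Rightarrow> real \<Rightarrow> real) \<Rightarrow> (real \<Rightarrow> real \<Rightarrow> real) \<Rightarrow> (real \<Rightarrow> real \<Rightarrow> real)
    \<Rightarrow> bool" where
  "rotating_cylinder_bc R1 R2 \<omega>1 \<omega>2 vr v\<theta> vz \<longleftrightarrow>
    (\<forall>z. vr R1 z = 0 \<and> vr R2 z = 0 \<and> vz R1 z = 0 \<and> vz R2 z = 0
       \<and> v\<theta> R1 z = R1 * \<omega>1 \<and> v\<theta> R2 z = R2 * \<omega>2)"

definition cyl_domain :: "real \<Rightarrow> real \<Rightarrow> (real ^ 3) set" where
  "cyl_domain R1 R2 = {x. R1 < sqrt ((x $ 1)\<^sup>2 + (x $ 2)\<^sup>2) \<and> sqrt ((x $ 1)\<^sup>2 + (x $ 2)\<^sup>2) < R2}"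

definition e_r :: "real \<Rightarrow> real ^ 3" where
  "e_r \<theta> = vector [cos \<theta>, sin \<theta>, 0]"

definition e_\<theta> :: "real \<Rightarrow> real ^ 3" where
  "e_\<theta> \<theta> = vector [- sin \<theta>, cos \<theta>, 0]"

definition e_z :: "real ^ 3" where
  "e_z = vector [0, 0, 1]"

definition cyl_field ::
  "(real \<Rightarrow> real \<Rightarrow> real) \<Rightarrow> (real \<Rightarrow> real \<Rightarrow> real) \<Rightarrow> (real \<Rightarrow> real \<Rightarrow> real) \<Rightarrow> real ^ 3 \<Rightarrow> real ^ 3" where
  "cyl_field vr v\<theta> vz x =
    (let r = sqrt ((x $ 1)\<^sup>2 + (x $ 2)\<^sup>2); \<theta> = Arg (Complex (x $ 1) (x $ 2)); z = x $ 3
     in vr r z *\<^sub>R e_r \<theta> + v\<theta> r z *\<^sub>R e_\<theta> \<theta> + vz r z *\<^sub>R e_z)"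

text \<open>\<open>esssup\<close> is \<open>\<infinity>\<close> for non-measurable functions; this does not arise for
  \<open>cyl_field\<close> on the cylindrical domain when the components are continuous on the strip: the branch
  jump of \<open>Arg\<close> disappears in \<open>cos\<close> and \<open>sin\<close>.\<close>

definition Linfty_norm :: "(real ^ 3) set \<Rightarrow> (real ^ 3 \<Rightarrow> real ^ 3) \<Rightarrow> ereal" where
  "Linfty_norm D v = esssup (lebesgue_on D) (\<lambda>x. ereal (norm (v x)))"

definition \<eta>_ratio :: "real \<Rightarrow> real \<Rightarrow> real" where
  "\<eta>_ratio R1 R2 = R1 / R2"

text \<open>Only meaningful for \<open>\<omega>1 \<noteq> 0\<close>.\<close>
definition \<mu>_ratio :: "real \<Rightarrow> real \<Rightarrow> real" where
  "\<mu>_ratio \<omega>1 \<omega>2 = \<omega>2 / \<omega>1"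

definition couette_A :: "real \<Rightarrow> real \<Rightarrow> real \<Rightarrow> real \<Rightarrow> real" where
  "couette_A R1 R2 \<omega>1 \<omega>2 = (let \<eta> = \<eta>_ratio R1 R2; \<mu> = \<mu>_ratio \<omega>1 \<omega>2 in
     if \<omega>1 \<noteq> 0 then (\<mu> - \<eta>\<^sup>2) / (1 - \<eta>\<^sup>2) * \<omega>1 else 1 / (1 - \<eta>\<^sup>2) * \<omega>2)"

definition couette_B :: "real \<Rightarrow> real \<Rightarrow> real \<Rightarrow> real \<Rightarrow> real" where
  "couette_B R1 R2 \<omega>1 \<omega>2 = (let \<eta> = \<eta>_ratio R1 R2; \<mu> = \<mu>_ratio \<omega>1 \<omega>2 in
     if \<omega>1 \<noteq> 0 then (1 - \<mu>) / (1 - \<eta>\<^sup>2) * \<omega>1 * R1\<^sup>2 else - (1 / (1 - \<eta>\<^sup>2) * \<omega>2 * R1\<^sup>2))"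

text \<open>Boundedness in \<open>z\<close> is only required separately for each \<open>r\<close>; boundedness of \<open>p\<close> on the whole
  domain is a special case.\<close>

definition bounded_in_z :: "real \<Rightarrow> real \<Rightarrow> (real \<Rightarrow> real \<Rightarrow> real) \<Rightarrow> bool" where
  "bounded_in_z R1 R2 p \<longleftrightarrow> (\<forall>r\<in>{R1<..<R2}. bounded (range (\<lambda>z. p r z)))"

definition periodic_in_z :: "real \<Rightarrow> real \<Rightarrow> (real \<Rightarrow> real \<Rightarrow> real) \<Rightarrow> bool" where
  "periodic_in_z R1 R2 p \<longleftrightarrow> (\<exists>L>0. \<forall>r\<in>{R1<..<R2}. \<forall>z. p r (z + L) = p r z)"

end

theory Submission
  imports Defs
begin

text \<open>Let \<open>u\<close> be the difference between \<open>v\<close> and the sum of the Couette flow and the Poiseuille flow with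
  the same axial flux. Then \<open>u\<close> vanishes on both cylinders and has zero flux, so its stream function
  \<open>\<psi>\<close> (\<open>\<partial>\<^sub>r \<psi> = r u\<^sup>z\<close>, \<open>\<partial>\<^sub>z \<psi> = - r u\<^sup>r\<close>) vanishes there as well. Test the equation for \<open>u\<close> with
  the meridional field generated by \<open>\<zeta> \<psi>\<close> and with \<open>\<zeta> u\<^sup>\<theta>\<close>, where \<open>\<zeta> = (1 - z\<^sup>2 / L\<^sup>2)\<^sup>4\<close>. The test field
  is divergence free, so the pressure drops out. Since \<open>\<zeta>\<close> does not depend on \<open>r\<close>, Poincare's inequality
  in \<open>r\<close> holds with weight \<open>\<zeta>\<close>, and smallness lets the viscous term absorb all convective terms.
  What remains contains \<open>\<zeta>'\<close> or \<open>\<zeta>''\<close>, both of size \<open>O(\<surd>\<zeta> / L)\<close>, so Young's inequality gives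
  \<open>\<integral> \<zeta> |\<nabla>u|\<^sup>2 \<le> C L\<^sup>-\<^sup>2 \<integral>\<^bsub>|z| \<le> L\<^esub> (|u|\<^sup>2 + \<psi>\<^sup>2) = O(1 / L)\<close>, and \<open>L \<rightarrow> \<infinity>\<close> forces \<open>u = 0\<close>.\<close>

subsection \<open>Pointwise energy estimate\<close>

lemma abs_mult3_le_squares:
  fixes a b c k :: real
  assumes "\<bar>c\<bar> \<le> k"
  shows "\<bar>c * (a * b)\<bar> \<le> k * (a\<^sup>2 + b\<^sup>2) / 2"
proof -
  have "\<bar>a * b\<bar> \<le> (a\<^sup>2 + b\<^sup>2) / 2"
    using sum_squares_bound[of "\<bar>a\<bar>" "\<bar>b\<bar>"] by (simp add: abs_mult)
  then have "\<bar>c\<bar> * \<bar>a * b\<bar> \<le> k * ((a\<^sup>2 + b\<^sup>2) / 2)"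
    using assms by (intro mult_mono) auto
  then show ?thesis by (simp add: abs_mult)
qed

lemma abs_mult4_le:
  fixes s t k b a :: real
  assumes "\<bar>s\<bar> \<le> t" "\<bar>k\<bar> \<le> K" "\<bar>b\<bar> \<le> M"
  shows "\<bar>s * k * b * a\<bar> \<le> t * (K * M) * \<bar>a\<bar>"
proof -
  have "\<bar>k\<bar> * \<bar>b\<bar> \<le> K * M" using assms by (intro mult_mono) auto
  then have "\<bar>s\<bar> * (\<bar>k\<bar> * \<bar>b\<bar>) \<le> t * (K * M)" using assms by (intro mult_mono) auto
  then have "\<bar>s\<bar> * (\<bar>k\<bar> * \<bar>b\<bar>) * \<bar>a\<bar> \<le> t * (K * M) * \<bar>a\<bar>" by (rule mult_right_mono) simp
  then show ?thesis by (simp add: abs_mult mult.assoc)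
qed

lemma young_weighted:
  fixes x y \<delta> :: real
  assumes "\<delta> > 0"
  shows "x * y \<le> \<delta> * x\<^sup>2 + y\<^sup>2 / (4 * \<delta>)"
proof -
  have "0 \<le> (2 * \<delta> * x - y)\<^sup>2 / (4 * \<delta>)" using assms by simp
  also have "\<dots> = \<delta> * x\<^sup>2 - x * y + y\<^sup>2 / (4 * \<delta>)"
    using assms by (simp add: field_simps power2_eq_square)
  finally show ?thesis by simp
qed

text \<open>The radial weight \<open>r\<close> of the test field cancels every \<open>1 / r\<close>,
  so each product is a coefficient of size \<open>\<epsilon>\<close> times two entries of
  \<open>u\<close> and its gradient, and \<open>2 a b \<le> a\<^sup>2 + b\<^sup>2\<close> applies.
  \<open>w\<close> stands for the full axial velocity, \<open>V\<close> and \<open>V'\<close> for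
  the Couette profile and its derivative, \<open>W'\<close> for the derivative of the Poiseuille
  profile. The component \<open>h\<close> occurs only among the squared entries, so it may be
  large.\<close>

lemma convective_terms_bound:
  fixes f g h :: real
  assumes r: "0 < R1" "R1 \<le> r" "r \<le> R2"
    and e: "\<bar>f\<bar> \<le> \<epsilon>" "\<bar>g\<bar> \<le> \<epsilon>" "\<bar>w\<bar> \<le> \<epsilon>" "\<bar>V\<bar> \<le> \<epsilon>" "\<bar>V'\<bar> \<le> \<epsilon>" "\<bar>W'\<bar> \<le> \<epsilon>"
  shows "\<bar>(f * fr + w * fz - (2 * V * g + g\<^sup>2) / r) * (r * f)
      + (f * (gr + V') + w * gz + f * (g + V) / r) * (r * g)
      + (f * (hr + W') + w * hz) * (r * h)\<bar>
    \<le> \<epsilon> * (2 * R2 + 3) * (fr\<^sup>2 + fz\<^sup>2 + gr\<^sup>2 + gz\<^sup>2 + hr\<^sup>2 + hz\<^sup>2 + (f\<^sup>2 + g\<^sup>2 + h\<^sup>2))" (is "\<bar>?N\<bar> \<le> ?B")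
proof -
  have rp: "r > 0" using r by linarith
  have e0: "0 \<le> \<epsilon>" using e(1) by linarith
  have er: "\<bar>x * r\<bar> \<le> \<epsilon> * R2" if "\<bar>x\<bar> \<le> \<epsilon>" for x
    using that rp r by (auto simp: abs_mult intro!: mult_mono)
  \<comment> \<open>Each summand is arranged as a small coefficient times a product of two entries
    to be squared.\<close>
  have N: "?N = f*r * (f*fr) + w*r * (f*fz) + (- (2 * V + g)) * (g*f) + f*r*(g*gr) + V'*r*(f*g)
      + w*r*(g*gz) + (g+V)*(f*g) + f*r*(h*hr) + W'*r*(f*h) + w*r*(h*hz)"
    using rp by (simp add: field_simps power2_eq_square)
  have "\<bar>?N\<bar> \<le> \<epsilon>*R2 * (f\<^sup>2+fr\<^sup>2)/2 + \<epsilon>*R2 * (f\<^sup>2+fz\<^sup>2)/2 + (3*\<epsilon>) * (g\<^sup>2+f\<^sup>2)/2 + \<epsilon>*R2*(g\<^sup>2+gr\<^sup>2)/2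
     + \<epsilon>*R2*(f\<^sup>2+g\<^sup>2)/2 + \<epsilon>*R2*(g\<^sup>2+gz\<^sup>2)/2 + (2*\<epsilon>)*(f\<^sup>2+g\<^sup>2)/2 + \<epsilon>*R2*(h\<^sup>2+hr\<^sup>2)/2
     + \<epsilon>*R2*(f\<^sup>2+h\<^sup>2)/2 + \<epsilon>*R2*(h\<^sup>2+hz\<^sup>2)/2"
    unfolding N using e
    by (intro order_trans[OF abs_triangle_ineq] add_mono abs_mult3_le_squares er) linarith+
  also have "\<dots> = \<epsilon>*R2 * ((fr\<^sup>2+fz\<^sup>2+gr\<^sup>2+gz\<^sup>2+hr\<^sup>2+hz\<^sup>2)/2 + (2 * f\<^sup>2 + 3/2 * g\<^sup>2 + 3/2 * h\<^sup>2)) + \<epsilon> * (5/2 * (f\<^sup>2+g\<^sup>2))"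
    by (simp add: field_simps)
  also have "\<dots> \<le> \<epsilon>*R2 * (2 * (fr\<^sup>2 + fz\<^sup>2 + gr\<^sup>2 + gz\<^sup>2 + hr\<^sup>2 + hz\<^sup>2 + (f\<^sup>2 + g\<^sup>2 + h\<^sup>2)))
      + \<epsilon> * (3 * (fr\<^sup>2 + fz\<^sup>2 + gr\<^sup>2 + gz\<^sup>2 + hr\<^sup>2 + hz\<^sup>2 + (f\<^sup>2 + g\<^sup>2 + h\<^sup>2)))"
    using e0 rp r by (intro add_mono mult_left_mono) (auto simp: field_simps)
  also have "\<dots> = ?B" by (simp add: algebra_simps)
  finally show ?thesis .
qed

text \<open>Each term carries \<open>\<zeta>'\<close> or \<open>\<zeta>''\<close>, hence a factor
  \<open>\<phi> / L\<close>, and a factor bounded by \<open>M\<close>. Young's inequality moves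
  \<open>\<phi>\<close> times the remaining entry into a \<open>\<delta>\<close>-fraction of the
  energy and leaves a remainder of order \<open>M\<^sup>2 / L\<^sup>2\<close>. In use
  \<open>\<phi>\<^sup>2 = \<zeta>\<close>.\<close>

lemma cutoff_terms_bound:
  fixes f g h :: real
  assumes pos: "0 < R1" "R1 \<le> r" "r \<le> R2" "\<nu> > 0" "L \<ge> 1" "\<delta> > 0" "0 \<le> \<phi>"
    and e: "\<epsilon> \<le> 1" "\<bar>f\<bar> \<le> \<epsilon>" "\<bar>g\<bar> \<le> \<epsilon>" "\<bar>w\<bar> \<le> \<epsilon>" "\<bar>V\<bar> \<le> \<epsilon>"
    and M: "\<bar>f\<bar> \<le> M" "\<bar>g\<bar> \<le> M" "\<bar>h\<bar> \<le> M" "\<bar>\<psi>\<bar> \<le> M"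
    and \<zeta>: "\<bar>\<zeta>'\<bar> \<le> 8 * \<phi> / L" "\<bar>\<zeta>''\<bar> \<le> 56 * \<phi> / L"
  shows "\<bar>(f * fr + w * fz - (2 * V * g + g\<^sup>2) / r) * (\<zeta>' * \<psi>)\<bar>
      + \<bar>2 * \<nu> * \<zeta>' * r * f * fz + \<nu> * \<zeta>' * r * (g * gz + h * hz) - \<nu> * \<zeta>' * r * h * (fr + f / r) - \<nu> * \<zeta>'' * \<psi> * fz\<bar>
    \<le> \<delta> * \<phi>\<^sup>2 * (fr\<^sup>2 + fz\<^sup>2 + gr\<^sup>2 + gz\<^sup>2 + hr\<^sup>2 + hz\<^sup>2 + (f\<^sup>2 + g\<^sup>2 + h\<^sup>2))
      + 3 * (M * (8 + 24 / R1 + 16 * \<nu> * R2 + 64 * \<nu>))\<^sup>2 / (2 * \<delta> * L\<^sup>2)" (is "\<bar>?N\<bar> + \<bar>?T\<bar> \<le> ?B")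
proof -
  have rp: "r > 0" using pos by linarith
  \<comment> \<open>\<open>K\<close> dominates each of the six coefficients that are collected at
    the end.\<close>
  define K where "K = 8 + 24 / R1 + 16 * \<nu> * R2 + 64 * \<nu>"
  define t where "t = \<phi> / L"
  define S where "S = \<bar>fr\<bar> + \<bar>fz\<bar> + \<bar>gz\<bar> + \<bar>hz\<bar> + \<bar>f\<bar> + \<bar>g\<bar>"
  have t: "\<bar>\<zeta>'\<bar> \<le> 8 * t" "\<bar>\<zeta>''\<bar> \<le> 56 * t" "0 \<le> t"
    using \<zeta> pos by (simp_all add: t_def)
  have tm: "\<bar>- \<zeta>'\<bar> \<le> 8 * t" "\<bar>- \<zeta>''\<bar> \<le> 56 * t" using t by simp_all
  have M0: "0 \<le> M" using M(1) by linarith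
  have 1: "\<bar>r\<bar> \<le> R2" "\<bar>2*r\<bar> \<le> 2*R2" "\<bar>1::real\<bar> \<le> 1" using rp pos by auto
  have Vg: "\<bar>(2 * V + g) / r\<bar> \<le> 3 / R1"
  proof -
    have "\<bar>2 * V + g\<bar> / \<bar>r\<bar> \<le> 3 / R1" using e pos rp by (intro frac_le) auto
    then show ?thesis by (simp add: abs_divide)
  qed
  have w1: "\<bar>f\<bar> \<le> 1" "\<bar>w\<bar> \<le> 1" using e by auto
  \<comment> \<open>The factors are ordered as cutoff derivative, coefficient, quantity bounded by
    \<open>M\<close>, and entry kept for the energy, as \<open>abs_mult4_le\<close> expects.\<close>
  have "?N = \<zeta>' * f * \<psi> * fr + \<zeta>' * w * \<psi> * fz + (-\<zeta>') * ((2 * V + g) / r) * \<psi> * g"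
    by (simp add: field_simps power2_eq_square add_divide_distrib)
  also have "\<bar>\<dots>\<bar> \<le> 8 * t * (1 * M) * \<bar>fr\<bar> + 8 * t * (1 * M) * \<bar>fz\<bar> + 8 * t * (3 / R1 * M) * \<bar>g\<bar>"
    by (intro order_trans[OF abs_triangle_ineq] add_mono abs_mult4_le; fact M t w1 Vg tm)
  finally have N: "\<bar>?N\<bar> \<le> 8 * t * (1 * M) * \<bar>fr\<bar> + 8 * t * (1 * M) * \<bar>fz\<bar> + 8 * t * (3 / R1 * M) * \<bar>g\<bar>" .
  have "?T = \<nu> * (\<zeta>' * (2*r) * f * fz + \<zeta>' * r * g * gz + \<zeta>' * r * h * hz + (-\<zeta>') * r * h * fr
      + (-\<zeta>') * 1 * h * f + (-\<zeta>'') * 1 * \<psi> * fz)"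
    using rp by (simp add: field_simps power2_eq_square)
  also have "\<bar>\<dots>\<bar> = \<nu> * \<bar>\<zeta>' * (2*r) * f * fz + \<zeta>' * r * g * gz + \<zeta>' * r * h * hz + (-\<zeta>') * r * h * fr
      + (-\<zeta>') * 1 * h * f + (-\<zeta>'') * 1 * \<psi> * fz\<bar>"
    using pos by (simp only: abs_mult)
  also have "\<dots> \<le> \<nu> * (8*t*(2*R2*M)*\<bar>fz\<bar> + 8*t*(R2*M)*\<bar>gz\<bar> + 8*t*(R2*M)*\<bar>hz\<bar> + 8*t*(R2*M)*\<bar>fr\<bar>
      + 8*t*(1*M)*\<bar>f\<bar> + 56*t*(1*M)*\<bar>fz\<bar>)"
    by (intro mult_left_mono order_trans[OF abs_triangle_ineq] add_mono abs_mult4_le;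
        fact M t tm 1 less_imp_le[OF pos(4)])
  finally have T: "\<bar>?T\<bar> \<le> \<nu> * (8*t*(2*R2*M)*\<bar>fz\<bar> + 8*t*(R2*M)*\<bar>gz\<bar> + 8*t*(R2*M)*\<bar>hz\<bar> + 8*t*(R2*M)*\<bar>fr\<bar>
      + 8*t*(1*M)*\<bar>f\<bar> + 56*t*(1*M)*\<bar>fz\<bar>)" .
  have R: "\<nu> * R2 \<ge> 0" using pos by simp
  have KR: "24 / R1 \<ge> 0" using pos by simp
  have "\<bar>?N\<bar> + \<bar>?T\<bar> \<le> t * M * ((8 + 8 * (\<nu>*R2)) * \<bar>fr\<bar> + (8 + 16 * (\<nu>*R2) + 56 * \<nu>) * \<bar>fz\<bar>
      + 8 * (\<nu>*R2) * \<bar>gz\<bar> + 8 * (\<nu>*R2) * \<bar>hz\<bar> + 8 * \<nu> * \<bar>f\<bar> + 24 / R1 * \<bar>g\<bar>)"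
    using add_mono[OF N T] by (simp add: algebra_simps)
  also have "\<dots> \<le> t * M * (K * \<bar>fr\<bar> + K * \<bar>fz\<bar> + K * \<bar>gz\<bar> + K * \<bar>hz\<bar> + K * \<bar>f\<bar> + K * \<bar>g\<bar>)"
    using t M0 R pos KR
    by (intro mult_left_mono add_mono mult_right_mono mult_nonneg_nonneg) (auto simp: K_def)
  also have "\<dots> = (\<phi> * \<bar>fr\<bar>) * (M * K / L) + (\<phi> * \<bar>fz\<bar>) * (M * K / L) + (\<phi> * \<bar>gz\<bar>) * (M * K / L)
     + (\<phi> * \<bar>hz\<bar>) * (M * K / L) + (\<phi> * \<bar>f\<bar>) * (M * K / L) + (\<phi> * \<bar>g\<bar>) * (M * K / L)"
    by (simp add: t_def algebra_simps add_divide_distrib)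
  \<comment> \<open>Young's inequality is used once per entry; the six remainders with factor
    \<open>1 / (4 * \<delta>)\<close> add up to the factor
    \<open>3 / (2 * \<delta>)\<close>.\<close>
  also have "\<dots> \<le> (\<delta> * (\<phi> * \<bar>fr\<bar>)\<^sup>2 + (M * K / L)\<^sup>2 / (4 * \<delta>)) + (\<delta> * (\<phi> * \<bar>fz\<bar>)\<^sup>2 + (M * K / L)\<^sup>2 / (4 * \<delta>))
     + (\<delta> * (\<phi> * \<bar>gz\<bar>)\<^sup>2 + (M * K / L)\<^sup>2 / (4 * \<delta>)) + (\<delta> * (\<phi> * \<bar>hz\<bar>)\<^sup>2 + (M * K / L)\<^sup>2 / (4 * \<delta>))
     + (\<delta> * (\<phi> * \<bar>f\<bar>)\<^sup>2 + (M * K / L)\<^sup>2 / (4 * \<delta>)) + (\<delta> * (\<phi> * \<bar>g\<bar>)\<^sup>2 + (M * K / L)\<^sup>2 / (4 * \<delta>))"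
    using pos by (intro add_mono young_weighted)
  also have "\<dots> = \<delta> * \<phi>\<^sup>2 * (fr\<^sup>2 + fz\<^sup>2 + gz\<^sup>2 + hz\<^sup>2 + f\<^sup>2 + g\<^sup>2) + 6 * ((M * K / L)\<^sup>2 / (4 * \<delta>))"
    by (simp add: power_mult_distrib algebra_simps)
  also have "6 * ((M * K / L)\<^sup>2 / (4 * \<delta>)) = 3 * (M * K)\<^sup>2 / (2 * \<delta> * L\<^sup>2)"
    using pos by (simp add: field_simps)
  also have "\<delta> * \<phi>\<^sup>2 * (fr\<^sup>2 + fz\<^sup>2 + gz\<^sup>2 + hz\<^sup>2 + f\<^sup>2 + g\<^sup>2)
     \<le> \<delta> * \<phi>\<^sup>2 * (fr\<^sup>2 + fz\<^sup>2 + gr\<^sup>2 + gz\<^sup>2 + hr\<^sup>2 + hz\<^sup>2 + (f\<^sup>2 + g\<^sup>2 + h\<^sup>2))"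
    using pos by (intro mult_left_mono) auto
  finally show ?thesis unfolding K_def by simp
qed

text \<open>The two \<open>\<kappa>\<close> terms are \<open>\<partial>\<^sub>r (\<kappa> \<zeta> (r - R2) |u|\<^sup>2)\<close>: adding this exact derivative to the energy
  density makes Poincare's inequality pointwise.\<close>

lemma energy_density_coercive:
  fixes f g h :: real
  assumes pos: "0 < R1" "R1 < R2" "R1 \<le> r" "r \<le> R2" "\<nu> > 0" "L \<ge> 1" "0 \<le> \<phi>"
    and lam: "\<kappa> = \<nu> * R1 / (4 * (R2 - R1)\<^sup>2)" and c: "c = min (\<nu> * R1 / 2) (\<kappa> / 2)"
    and eps: "\<epsilon> \<le> 1" "\<epsilon> * (2 * R2 + 3) \<le> c / 4"
    and e: "\<bar>f\<bar> \<le> \<epsilon>" "\<bar>g\<bar> \<le> \<epsilon>" "\<bar>w\<bar> \<le> \<epsilon>" "\<bar>V\<bar> \<le> \<epsilon>" "\<bar>V'\<bar> \<le> \<epsilon>" "\<bar>W'\<bar> \<le> \<epsilon>"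
    and M: "\<bar>f\<bar> \<le> M" "\<bar>g\<bar> \<le> M" "\<bar>h\<bar> \<le> M" "\<bar>\<psi>\<bar> \<le> M"
    and \<zeta>: "\<zeta> = \<phi>\<^sup>2" "\<bar>\<zeta>'\<bar> \<le> 8 * \<phi> / L" "\<bar>\<zeta>''\<bar> \<le> 56 * \<phi> / L"
  shows "c / 2 * \<zeta> * (fr\<^sup>2 + fz\<^sup>2 + gr\<^sup>2 + gz\<^sup>2 + hr\<^sup>2 + hz\<^sup>2)
      - 6 * (M * (8 + 24 / R1 + 16 * \<nu> * R2 + 64 * \<nu>))\<^sup>2 / c / L\<^sup>2
    \<le> (f * fr + w * fz - (2 * V * g + g\<^sup>2) / r) * (r * \<zeta> * f - \<zeta>' * \<psi>)
      + (f * (gr + V') + w * gz + f * (g + V) / r) * (r * \<zeta> * g)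
      + (f * (hr + W') + w * hz) * (r * \<zeta> * h)
      + \<nu> * \<zeta> * (r * (fr\<^sup>2 + fz\<^sup>2 + gr\<^sup>2 + gz\<^sup>2 + hr\<^sup>2 + hz\<^sup>2) + (f\<^sup>2 + g\<^sup>2) / r)
      + (2 * \<nu> * \<zeta>' * r * f * fz + \<nu> * \<zeta>' * r * (g * gz + h * hz) - \<nu> * \<zeta>' * r * h * (fr + f / r) - \<nu> * \<zeta>'' * \<psi> * fz)
      + \<kappa> * \<zeta> * (f\<^sup>2 + g\<^sup>2 + h\<^sup>2) + 2 * \<kappa> * \<zeta> * (r - R2) * (f * fr + g * gr + h * hr)"
    (is "_ \<le> (?n1 * _ + ?N2 + ?N3 + ?Visc + ?T + ?P1 + ?P2)")
proof -
  define D U where "D = fr\<^sup>2 + fz\<^sup>2 + gr\<^sup>2 + gz\<^sup>2 + hr\<^sup>2 + hz\<^sup>2" and "U = f\<^sup>2 + g\<^sup>2 + h\<^sup>2"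
  define d where "d = R2 - R1"
  have rp: "r > 0" and d: "d > 0" using pos by (auto simp: d_def)
  have lp: "\<kappa> > 0" using pos by (simp add: lam)
  have cp: "c > 0" using pos lp by (simp add: c)
  have z0: "0 \<le> \<zeta>" by (simp add: \<zeta>)
  have DU: "0 \<le> D" "0 \<le> U" by (simp_all add: D_def U_def)
  let ?n = "?n1 * (r * f) + (f * (gr + V') + w * gz + f * (g + V) / r) * (r * g)
      + (f * (hr + W') + w * hz) * (r * h)"
  have "\<bar>?n\<bar> \<le> \<epsilon> * (2 * R2 + 3) * (D + U)"
    unfolding D_def U_def using convective_terms_bound[of R1 r R2 f \<epsilon> g w V V' W'] pos e by blast
  \<comment> \<open>Budget: convection may use a quarter of the coercivity constant
    \<open>c\<close>, and the cutoff terms, taken with \<open>\<delta> = c / 4\<close>, another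
    quarter. Half of it survives.\<close>
  also have "\<dots> \<le> c / 4 * (D + U)" using eps DU by (intro mult_right_mono) auto
  finally have "- ?n \<le> c / 4 * (D + U)" by (rule abs_le_D2)
  then have "- (c / 4 * (D + U)) \<le> ?n" by (rule minus_le_iff[THEN iffD1])
  then have A1: "\<zeta> * - (c / 4 * (D + U)) \<le> \<zeta> * ?n" using z0 by (rule mult_left_mono)
  have "\<bar>?n1 * (\<zeta>' * \<psi>)\<bar> + \<bar>?T\<bar> \<le> c / 4 * \<phi>\<^sup>2 * (D + U)
      + 3 * (M * (8 + 24 / R1 + 16 * \<nu> * R2 + 64 * \<nu>))\<^sup>2 / (2 * (c / 4) * L\<^sup>2)"
    unfolding D_def U_def
    by (intro cutoff_terms_bound[OF pos(1,3,4,5,6) _ pos(7) eps(1) e(1-4) M \<zeta>(2,3)]) (use cp in simp)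
  also have "3 * (M * (8 + 24 / R1 + 16 * \<nu> * R2 + 64 * \<nu>))\<^sup>2 / (2 * (c / 4) * L\<^sup>2)
      = 6 * (M * (8 + 24 / R1 + 16 * \<nu> * R2 + 64 * \<nu>))\<^sup>2 / c / L\<^sup>2"
    by simp
  finally have A2: "\<bar>?n1 * (\<zeta>' * \<psi>)\<bar> + \<bar>?T\<bar> \<le> c / 4 * \<zeta> * (D + U)
      + 6 * (M * (8 + 24 / R1 + 16 * \<nu> * R2 + 64 * \<nu>))\<^sup>2 / c / L\<^sup>2" by (simp add: \<zeta>)
  have A3: "\<nu> * \<zeta> * (R1 * D) \<le> ?Visc"
  proof -
    have "R1 * D \<le> r * D + (f\<^sup>2 + g\<^sup>2) / r"
      using pos DU rp by (intro order_trans[OF mult_right_mono[of R1 r D]]) auto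
    then show ?thesis unfolding D_def using pos z0 by (intro mult_left_mono) auto
  qed
  \<comment> \<open>The weights are balanced by the value of \<open>\<kappa>\<close>: after
    multiplication by \<open>2 * \<kappa> * \<zeta>\<close>, the first part costs half of the gain
    \<open>\<kappa> * \<zeta> * U\<close>, and the second part costs
    \<open>\<nu> * R1 / 2 * \<zeta> * D\<close>, half of the viscous gain, because
    \<open>2 * \<kappa> * d\<^sup>2 = \<nu> * R1 / 2\<close>.\<close>
  have y: "- (x\<^sup>2 / 4 + d\<^sup>2 * y\<^sup>2) \<le> (r - R2) * (x * y)" for x y :: real
  proof -
    have "(d - (R2 - r)) * (d + (R2 - r)) \<ge> 0" using pos by (intro mult_nonneg_nonneg) (auto simp: d_def)
    then have "(R2 - r)\<^sup>2 \<le> d\<^sup>2" by (simp add: algebra_simps power2_eq_square)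
    then have "(R2 - r)\<^sup>2 * y\<^sup>2 \<le> d\<^sup>2 * y\<^sup>2" by (rule mult_right_mono) simp
    moreover have "0 \<le> (x / 2 - (R2 - r) * y)\<^sup>2" by simp
    ultimately show ?thesis by (simp add: power2_eq_square algebra_simps)
  qed
  have "- (U / 4 + d\<^sup>2 * (fr\<^sup>2 + gr\<^sup>2 + hr\<^sup>2)) \<le> (r - R2) * (f * fr + g * gr + h * hr)"
    using y[of f fr] y[of g gr] y[of h hr] unfolding U_def
    by (simp add: algebra_simps add_divide_distrib)
  moreover have "d\<^sup>2 * (fr\<^sup>2 + gr\<^sup>2 + hr\<^sup>2) \<le> d\<^sup>2 * D" unfolding D_def by (intro mult_left_mono) auto
  ultimately have "- (U / 4 + d\<^sup>2 * D) \<le> (r - R2) * (f * fr + g * gr + h * hr)" by linarith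
  then have "2 * \<kappa> * \<zeta> * - (U / 4 + d\<^sup>2 * D) \<le> 2 * \<kappa> * \<zeta> * ((r - R2) * (f * fr + g * gr + h * hr))"
    using lp z0 by (intro mult_left_mono) auto
  moreover have "2 * \<kappa> * \<zeta> * - (U / 4 + d\<^sup>2 * D) = - (\<kappa> / 2 * \<zeta> * U) - \<nu> * R1 / 2 * (\<zeta> * D)"
    using d by (simp add: lam flip: d_def) (simp add: field_simps)
  ultimately have A4: "- (\<kappa> / 2 * \<zeta> * U) - \<nu> * R1 / 2 * (\<zeta> * D) \<le> ?P2" by (simp add: mult.assoc)
  have cc: "c \<le> \<nu> * R1 / 2" "c \<le> \<kappa> / 2" by (simp_all add: c)
  have A5: "c * (\<zeta> * D) \<le> \<nu> * R1 / 2 * (\<zeta> * D)" and A6: "c * (\<zeta> * U) \<le> \<kappa> / 2 * (\<zeta> * U)"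
    using z0 DU cc by (intro mult_right_mono; simp)+
  have A7: "?n1 * (r * \<zeta> * f - \<zeta>' * \<psi>) + ?N2 + ?N3 = \<zeta> * ?n - ?n1 * (\<zeta>' * \<psi>)"
    by (simp add: algebra_simps add_divide_distrib diff_divide_distrib)
  have A8: "0 \<le> c * (\<zeta> * U)" using cp z0 DU by simp
  have A9: "?P1 = \<kappa> / 2 * (\<zeta> * U) + \<kappa> / 2 * (\<zeta> * U)" by (simp add: U_def algebra_simps)
  have B1: "- (c * (\<zeta> * D)) / 4 - c * (\<zeta> * U) / 4 \<le> \<zeta> * ?n"
    by (rule order_trans[OF eq_refl A1]) (simp add: algebra_simps add_divide_distrib)
  have B2: "c / 4 * \<zeta> * (D + U) = c * (\<zeta> * D) / 4 + c * (\<zeta> * U) / 4"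
    by (simp add: algebra_simps add_divide_distrib)
  have B3: "\<nu> * R1 / 2 * (\<zeta> * D) + \<nu> * R1 / 2 * (\<zeta> * D) \<le> ?Visc"
    by (rule order_trans[OF eq_refl A3]) simp
  have B4: "- (\<kappa> / 2 * (\<zeta> * U)) - \<nu> * R1 / 2 * (\<zeta> * D) \<le> ?P2"
    using A4 by (simp add: mult.assoc)
  have B5: "c / 2 * \<zeta> * D = c * (\<zeta> * D) / 2" by simp
  \<comment> \<open>With the nonlinear quantities as atoms only a linear balance is left: the gains
    \<open>2 y\<close> and \<open>2 w\<close> less \<open>w + y\<close> give at least
    \<open>z + u\<close>, and the losses are two quarters of \<open>z + u\<close> together with
    \<open>e\<close>.\<close>
  have sum: "z / 2 - e \<le> n + v + t + p1 + p2"
    if "z \<le> y" "u \<le> w" "n = x - m" "0 \<le> u" "p1 = w + w" "- z / 4 - u / 4 \<le> x"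
      "\<bar>m\<bar> + \<bar>t\<bar> \<le> (z / 4 + u / 4) + e" "y + y \<le> v" "- w - y \<le> p2"
    for z e n v t p1 p2 x m u w y :: real
    using that by linarith
  show ?thesis
    unfolding D_def[symmetric] B5
    by (rule sum[OF A5 A6 A7 A8 A9 B1 A2[unfolded B2] B3[unfolded D_def[symmetric]] B4])
qed

text \<open>Integrating the inequality over \<open>[-L, L]\<close> cancels the values of
  \<open>G L\<close> at the ends and bounds the weighted energy by \<open>2 * C / L\<close>. On a
  fixed window of half-width \<open>M\<close> and for \<open>L \<ge> 2 * M\<close> the weight is at
  least \<open>(3 / 4) ^ 4 = 81 / 256\<close>, so letting \<open>L\<close> grow makes the integral
  of \<open>E\<close> over the window vanish.\<close>

lemma exhausting_cutoff_vanish: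
  fixes E :: "real \<Rightarrow> real"
  assumes E: "continuous_on UNIV E" "\<And>z. 0 \<le> E z" and c: "c > 0"
    and G: "\<And>L z. L \<ge> 1 \<Longrightarrow> z \<in> {-L..L} \<Longrightarrow> (G L has_real_derivative G' L z) (at z)"
    and G': "\<And>L z. L \<ge> 1 \<Longrightarrow> z \<in> {-L..L} \<Longrightarrow> c * (1 - z\<^sup>2 / L\<^sup>2) ^ 4 * E z - C / L\<^sup>2 \<le> G' L z"
    and G0: "\<And>L. L \<ge> 1 \<Longrightarrow> G L L = G L (-L)"
  shows "E z = 0"
proof -
  \<comment> \<open>Half-width of a nondegenerate window around 0 that contains
    \<open>z\<close>.\<close>
  define M where "M = \<bar>z\<bar> + 1"
  have M: "M \<ge> 1" "z \<in> {-M..M}" by (auto simp: M_def)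
  have intE: "E integrable_on {a..b}" for a b
    using E(1) by (intro integrable_continuous_interval) (auto intro: continuous_on_subset)
  have bound: "c * 81 / 256 * integral {-M..M} E \<le> 2 * C / L" if L: "L \<ge> 2 * M" for L
  proof -
    let ?F = "\<lambda>z. c * (1 - z\<^sup>2 / L\<^sup>2) ^ 4 * E z"
    have L1: "L \<ge> 1" using L M by linarith
    have cont: "continuous_on S ?F" for S
      using E(1) L1 by (intro continuous_intros continuous_on_subset[OF E(1)]) auto
    then have intF: "?F integrable_on {a..b}" for a b by (intro integrable_continuous_interval)
    have hi: "(G' L has_integral G L L - G L (-L)) {-L..L}"
      using L1 G[OF L1]
      by (intro fundamental_theorem_of_calculus)
        (auto intro: has_field_derivative_at_within simp flip: has_real_derivative_iff_has_vector_derivative)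
    have "((\<lambda>z. ?F z - C / L\<^sup>2) has_integral integral {-L..L} ?F - 2 * L * (C / L\<^sup>2)) {-L..L}"
      using integrable_integral[OF intF] has_integral_const_real[of "C / L\<^sup>2" "-L" L] L1
      by (auto intro!: has_integral_diff)
    from has_integral_le[OF this hi] have "integral {-L..L} ?F \<le> 2 * L * (C / L\<^sup>2)"
      using G'[OF L1] G0[OF L1] by simp
    also have "\<dots> = 2 * C / L" using L1 by (simp add: power2_eq_square)
    finally have u: "integral {-L..L} ?F \<le> 2 * C / L" .
    have "integral {-M..M} (\<lambda>z. c * 81 / 256 * E z) \<le> integral {-M..M} ?F"
    proof (rule integral_le)
      fix x assume x: "x \<in> {-M..M}"
      have "\<bar>x\<bar> \<le> L / 2" using x L by auto
      then have "x\<^sup>2 \<le> (L / 2)\<^sup>2" by (metis abs_ge_zero power2_abs power_mono)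
      then have "3 / 4 \<le> 1 - x\<^sup>2 / L\<^sup>2" using L1 by (simp add: field_simps)
      then have "(3 / 4) ^ 4 \<le> (1 - x\<^sup>2 / L\<^sup>2) ^ 4" by (intro power_mono) auto
      then have "c * (81 / 256) * E x \<le> c * (1 - x\<^sup>2 / L\<^sup>2) ^ 4 * E x"
        using c E(2) by (intro mult_right_mono mult_left_mono) (auto simp: field_simps)
      then show "c * 81 / 256 * E x \<le> ?F x" by simp
    qed (use intE intF in \<open>auto intro!: integrable_on_mult_right\<close>)
    also have "\<dots> \<le> integral {-L..L} ?F"
      using L M c E(2) intF by (intro integral_subset_le) auto
    finally show ?thesis using u by simp
  qed
  have "c * 81 / 256 * integral {-M..M} E \<le> 0"
  proof (rule tendsto_lowerbound)
    show "((\<lambda>L. 2 * C / L) \<longlongrightarrow> 0) at_top"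
      by (intro tendsto_divide_0[OF tendsto_const] filterlim_at_top_imp_at_infinity filterlim_ident)
    show "\<forall>\<^sub>F L in at_top. c * 81 / 256 * integral {-M..M} E \<le> 2 * C / L"
      using bound by (intro eventually_at_top_linorderI)
  qed simp
  moreover have "0 \<le> integral {-M..M} E" using E(2) intE by (intro integral_nonneg)
  ultimately have "integral {-M..M} E = 0" using c by (simp add: mult_le_0_iff)
  then show ?thesis
    using integral_eq_0_iff[of "-M" M E] continuous_on_subset[OF E(1)] E(2) M by auto
qed

subsection \<open>Calculus on the strip\<close>

text \<open>The partials are explicit arguments, with the radial one taken within
  \<open>{R1..R2}\<close>. They therefore make sense, one-sidedly, on the walls as well, where
  boundary terms have to be evaluated.\<close>

definition strip_C1 ::
  "real \<Rightarrow> real \<Rightarrow> (real \<Rightarrow> real \<Rightarrow> real) \<Rightarrow> (real \<Rightarrow> real \<Rightarrow> real) \<Rightarrow> (real \<Rightarrow> real \<Rightarrow> real) \<Rightarrow> bool"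
  where
  "strip_C1 R1 R2 f fr fz \<longleftrightarrow>
     continuous_on (strip R1 R2) (\<lambda>x. f (fst x) (snd x))
   \<and> continuous_on (strip R1 R2) (\<lambda>x. fr (fst x) (snd x))
   \<and> continuous_on (strip R1 R2) (\<lambda>x. fz (fst x) (snd x))
   \<and> (\<forall>r\<in>{R1..R2}. \<forall>z. ((\<lambda>s. f s z) has_real_derivative fr r z) (at r within {R1..R2}))
   \<and> (\<forall>r\<in>{R1..R2}. \<forall>z. ((\<lambda>s. f r s) has_real_derivative fz r z) (at z))"

lemma strip_C1_continuous_on:
  assumes "strip_C1 R1 R2 f fr fz"
  shows "continuous_on (strip R1 R2) (\<lambda>x. f (fst x) (snd x))"
    and "continuous_on (strip R1 R2) (\<lambda>x. fr (fst x) (snd x))"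
    and "continuous_on (strip R1 R2) (\<lambda>x. fz (fst x) (snd x))"
  using assms by (simp_all add: strip_C1_def)

lemma strip_C1_has_derivative:
  assumes "strip_C1 R1 R2 f fr fz" "r \<in> {R1..R2}"
  shows "((\<lambda>s. f s z) has_real_derivative fr r z) (at r within {R1..R2})"
    and "((\<lambda>s. f r s) has_real_derivative fz r z) (at z)"
  using assms by (simp_all add: strip_C1_def)

lemma strip_C1_has_derivative_interior:
  assumes "strip_C1 R1 R2 f fr fz" "r \<in> {R1<..<R2}"
  shows "((\<lambda>s. f s z) has_real_derivative fr r z) (at r)"
  using strip_C1_has_derivative(1)[OF assms(1), of r z] assms(2)
  by (simp add: at_within_Icc_at)

lemma strip_continuous_on_slice:
  assumes "continuous_on (strip R1 R2) (\<lambda>x. f (fst x) (snd x))" "S \<subseteq> {R1..R2}"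
  shows "continuous_on S (\<lambda>r. f r z)"
proof -
  have "continuous_on S (\<lambda>r. (\<lambda>x. f (fst x) (snd x)) (r, z))"
    by (rule continuous_on_compose2[OF assms(1)]) (use assms(2) in \<open>auto simp: strip_def intro!: continuous_intros\<close>)
  then show ?thesis by simp
qed

lemma Ck_on_imp_continuous_on:
  assumes "Ck_on k S f"
  shows "continuous_on S f"
proof (cases k)
  case (Suc n)
  then obtain f1 f2 where "\<And>x. x \<in> S \<Longrightarrow> (f has_derivative (\<lambda>h. f1 x * fst h + f2 x * snd h)) (at x within S)"
    using assms by auto
  then show ?thesis by (rule has_derivative_continuous_on)
qed (use assms in simp)

text \<open>The total derivative relative to the strip is restricted to the two coordinate lines
  through a point. The partials keep their order of smoothness, so the step can be iterated.\<close>

lemma Ck_on_Suc_strip_C1: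
  assumes "Ck_on (Suc k) (strip R1 R2) (\<lambda>x. f (fst x) (snd x))"
  obtains fr fz where "strip_C1 R1 R2 f fr fz"
    "Ck_on k (strip R1 R2) (\<lambda>x. fr (fst x) (snd x))" "Ck_on k (strip R1 R2) (\<lambda>x. fz (fst x) (snd x))"
proof -
  let ?S = "strip R1 R2"
  let ?f = "\<lambda>x. f (fst x) (snd x)"
  obtain f1 f2 where d: "\<And>x. x \<in> ?S \<Longrightarrow> (?f has_derivative (\<lambda>h. f1 x * fst h + f2 x * snd h)) (at x within ?S)"
    and k: "Ck_on k ?S f1" "Ck_on k ?S f2"
    using assms by auto
  have dr: "((\<lambda>s. f s z) has_real_derivative f1 (r, z)) (at r within {R1..R2})" if "r \<in> {R1..R2}" for r z
  proof -
    have "(?f has_derivative (\<lambda>h. f1 (r, z) * fst h + f2 (r, z) * snd h)) (at (r, z) within (\<lambda>s. (s, z)) ` {R1..R2})"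
      using d[of "(r, z)"] that by (rule_tac has_derivative_subset) (auto simp: strip_def)
    from has_derivative_in_compose[OF _ this, of "\<lambda>s. (s, 0)"]
    have "((\<lambda>s. ?f (s, z)) has_derivative (\<lambda>s. f1 (r, z) * fst (s, 0::real) + f2 (r, z) * snd (s, 0::real))) (at r within {R1..R2})"
      by (simp add: has_derivative_Pair has_derivative_ident has_derivative_const)
    then show ?thesis by (simp add: has_field_derivative_def)
  qed
  have dz: "((\<lambda>s. f r s) has_real_derivative f2 (r, z)) (at z)" if "r \<in> {R1..R2}" for r z
  proof -
    have "(?f has_derivative (\<lambda>h. f1 (r, z) * fst h + f2 (r, z) * snd h)) (at (r, z) within range (\<lambda>s. (r, s)))"
      using d[of "(r, z)"] that by (rule_tac has_derivative_subset) (auto simp: strip_def)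
    from has_derivative_in_compose[OF _ this, of "\<lambda>s. (0, s)"]
    have "((\<lambda>s. ?f (r, s)) has_derivative (\<lambda>s. f1 (r, z) * fst (0::real, s) + f2 (r, z) * snd (0::real, s))) (at z)"
      by (simp add: has_derivative_Pair has_derivative_ident has_derivative_const)
    then show ?thesis by (simp add: has_field_derivative_def)
  qed
  show thesis
  proof (rule that[of "curry f1" "curry f2"])
    show "strip_C1 R1 R2 f (curry f1) (curry f2)"
      using Ck_on_imp_continuous_on[OF assms] Ck_on_imp_continuous_on[OF k(1)]
        Ck_on_imp_continuous_on[OF k(2)] dr dz by (simp add: strip_C1_def)
  qed (use k in simp_all)
qed

lemma smooth_obtain_partials:
  assumes "smooth_upto_boundary R1 R2 f"
  obtains fr fz frr frz fzr fzz
  where "strip_C1 R1 R2 f fr fz" "strip_C1 R1 R2 fr frr frz" "strip_C1 R1 R2 fz fzr fzz"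
proof -
  have "Ck_on (Suc (Suc 0)) (strip R1 R2) (\<lambda>(r, z). f r z)"
    using assms unfolding smooth_upto_boundary_def by blast
  then have "Ck_on (Suc (Suc 0)) (strip R1 R2) (\<lambda>x. f (fst x) (snd x))"
    by (simp only: case_prod_unfold)
  then obtain fr fz where 1: "strip_C1 R1 R2 f fr fz"
    "Ck_on (Suc 0) (strip R1 R2) (\<lambda>x. fr (fst x) (snd x))" "Ck_on (Suc 0) (strip R1 R2) (\<lambda>x. fz (fst x) (snd x))"
    by (rule Ck_on_Suc_strip_C1)
  from 1(2) obtain frr frz where 2: "strip_C1 R1 R2 fr frr frz" by (rule Ck_on_Suc_strip_C1)
  from 1(3) obtain fzr fzz where 3: "strip_C1 R1 R2 fz fzr fzz" by (rule Ck_on_Suc_strip_C1)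
  show thesis using that 1(1) 2 3 .
qed

lemma strip_C1_d_r: "strip_C1 R1 R2 f fr fz \<Longrightarrow> r \<in> {R1<..<R2} \<Longrightarrow> d_r f r z = fr r z"
  unfolding d_r_def by (rule DERIV_imp_deriv) (rule strip_C1_has_derivative_interior)

lemma strip_C1_d_z: "strip_C1 R1 R2 f fr fz \<Longrightarrow> r \<in> {R1<..<R2} \<Longrightarrow> d_z f r z = fz r z"
  unfolding d_z_def by (rule DERIV_imp_deriv) (auto intro: strip_C1_has_derivative)

lemma strip_C1_laplace_cyl:
  assumes f: "strip_C1 R1 R2 f fr fz" "strip_C1 R1 R2 fr frr frz" "strip_C1 R1 R2 fz fzr fzz"
    and r: "r \<in> {R1<..<R2}"
  shows "laplace_cyl f r z = frr r z + 1 / r * fr r z + fzz r z"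
proof -
  \<comment> \<open>The inner derivative is known to be \<open>fr\<close> only at interior radii;
    since these form an open set, agreement near \<open>r\<close> is enough for the outer
    derivative.\<close>
  have "d_r (d_r f) r z = deriv (\<lambda>s. fr s z) r"
    unfolding d_r_def[of "d_r f"]
  proof (rule deriv_cong_ev[OF _ refl])
    have "\<forall>\<^sub>F s in nhds r. s \<in> {R1<..<R2}" using r by (intro eventually_nhds_in_open) auto
    then show "\<forall>\<^sub>F s in nhds r. d_r f s z = fr s z"
      by eventually_elim (rule strip_C1_d_r[OF f(1)])
  qed
  moreover have "d_z (d_z f) r z = deriv (\<lambda>s. fz r s) z"
    unfolding d_z_def[of "d_z f"] using strip_C1_d_z[OF f(1) r] by presburger
  ultimately show ?thesis
    using strip_C1_d_r[OF f(2) r, of z] strip_C1_d_z[OF f(3) r, of z] strip_C1_d_r[OF f(1) r, of z]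
    by (simp add: laplace_cyl_def d_r_def d_z_def)
qed

lemma strip_continuous_on_swap:
  assumes "continuous_on (strip R1 R2) (\<lambda>x. f (fst x) (snd x))" "R1 \<le> a" "b \<le> R2"
  shows "continuous_on (UNIV \<times> cbox a b) (\<lambda>(z, r). f r z)"
proof -
  have "continuous_on (UNIV \<times> cbox a b) (\<lambda>y. (\<lambda>x. f (fst x) (snd x)) (snd y, fst y))"
    by (rule continuous_on_compose2[OF assms(1)])
      (use assms(2,3) in \<open>auto simp: strip_def intro!: continuous_intros\<close>)
  then show ?thesis by (simp add: case_prod_unfold)
qed

lemma strip_integral_has_derivative:
  assumes f: "continuous_on (strip R1 R2) (\<lambda>x. f (fst x) (snd x))"
    and fz: "continuous_on (strip R1 R2) (\<lambda>x. fz (fst x) (snd x))"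
    and d: "\<And>r z. r \<in> {R1..R2} \<Longrightarrow> ((\<lambda>s. f r s) has_real_derivative fz r z) (at z)"
    and ab: "R1 \<le> a" "b \<le> R2"
  shows "((\<lambda>z. integral {a..b} (\<lambda>r. f r z)) has_real_derivative integral {a..b} (\<lambda>r. fz r z)) (at z)"
proof -
  have "((\<lambda>z. integral (cbox a b) (\<lambda>r. f r z)) has_real_derivative integral (cbox a b) (\<lambda>r. fz r z)) (at z within UNIV)"
  proof (rule leibniz_rule_field_derivative)
    show "continuous_on (UNIV \<times> cbox a b) (\<lambda>(z, r). fz r z)" using strip_continuous_on_swap[OF fz ab] .
    show "(\<lambda>r. f r z) integrable_on cbox a b" for z
      using ab by (intro integrable_continuous strip_continuous_on_slice[OF f]) auto
  qed (use d ab in auto)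
  then show ?thesis by simp
qed

lemma strip_integral_continuous_on:
  fixes f :: "real \<Rightarrow> real \<Rightarrow> real"
  assumes "continuous_on (strip R1 R2) (\<lambda>x. f (fst x) (snd x))"
  shows "continuous_on UNIV (\<lambda>z. integral {R1..R2} (\<lambda>r. f r z))"
  using integral_continuous_on_param[where f = "\<lambda>z r. f r z",
      OF strip_continuous_on_swap[OF assms order_refl order_refl]] by simp

text \<open>A jointly continuous partial in \<open>z\<close> and the mere existence of the partial
  in \<open>r\<close> already give total differentiability. This serves the stream function, an
  integral with a variable endpoint.\<close>

lemma strip_continuous_on_partials:
  assumes fr: "\<And>r z. r \<in> {R1..R2} \<Longrightarrow> ((\<lambda>s. f s z) has_real_derivative fr r z) (at r within {R1..R2})"
    and fz: "\<And>r z. r \<in> {R1..R2} \<Longrightarrow> ((\<lambda>s. f r s) has_real_derivative fz r z) (at z)"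
    and c: "continuous_on (strip R1 R2) (\<lambda>x. fz (fst x) (snd x))"
  shows "continuous_on (strip R1 R2) (\<lambda>x. f (fst x) (snd x))"
proof -
  have c': "continuous_on ({R1..R2} \<times> UNIV) (\<lambda>(x, y). blinfun_mult_right (fz x y))"
    using c unfolding strip_def case_prod_unfold
    by (rule bounded_linear.continuous_on[OF bounded_linear_blinfun_mult_right])
  have "((\<lambda>(r, z). f r z) has_derivative (\<lambda>(tx, ty). fr r z * tx + blinfun_mult_right (fz r z) ty)) (at (r, z) within {R1..R2} \<times> UNIV)"
    if r: "r \<in> {R1..R2}" for r z
  proof (rule has_derivative_partialsI)
    show "((\<lambda>x. f x z) has_derivative (*) (fr r z)) (at r within {R1..R2})"
      using fr[OF r] by (simp add: has_field_derivative_def)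
    show "(f x has_derivative blinfun_apply (blinfun_mult_right (fz x y))) (at y)" if "x \<in> {R1..R2}" for x y
      using fz[OF that, of y] by (simp add: has_field_derivative_def)
    show "continuous (at (r, z) within {R1..R2} \<times> UNIV) (\<lambda>(x, y). blinfun_mult_right (fz x y))"
      using c' r by (auto simp: continuous_on_eq_continuous_within)
  qed auto
  then show ?thesis
    unfolding strip_def
    by (intro has_derivative_continuous_on[where f = "\<lambda>x. f (fst x) (snd x)"
          and f' = "\<lambda>x t. fr (fst x) (snd x) * fst t + blinfun_mult_right (fz (fst x) (snd x)) (snd t)"])
      (auto simp: case_prod_unfold)
qed

text \<open>The radial partial is the fundamental theorem of calculus. For the axial one,
  incompressibility turns \<open>s * hz\<close> into \<open>- (s * f)'\<close>, which integrates to
  \<open>- (r * f)\<close> because nothing flows through the inner wall.\<close>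

lemma stream_function:
  assumes f: "strip_C1 R1 R2 f fr fz" and h: "strip_C1 R1 R2 h hr hz"
    and div: "\<And>r z. r \<in> {R1<..<R2} \<Longrightarrow> f r z + r * fr r z + r * hz r z = 0"
    and f0: "\<And>z. f R1 z = 0"
  shows "strip_C1 R1 R2 (\<lambda>r z. integral {R1..r} (\<lambda>s. s * h s z)) (\<lambda>r z. r * h r z) (\<lambda>r z. - (r * f r z))"
proof -
  let ?\<psi> = "\<lambda>r z. integral {R1..r} (\<lambda>s. s * h s z)"
  note c = strip_C1_continuous_on[OF f] strip_C1_continuous_on[OF h]
  have ch: "continuous_on (strip R1 R2) (\<lambda>x. fst x * h (fst x) (snd x))"
    and chz: "continuous_on (strip R1 R2) (\<lambda>x. fst x * hz (fst x) (snd x))"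
    and cf: "continuous_on (strip R1 R2) (\<lambda>x. - (fst x * f (fst x) (snd x)))"
    using c by (auto intro!: continuous_intros)
  have dr: "((\<lambda>s. ?\<psi> s z) has_real_derivative r * h r z) (at r within {R1..R2})" if "r \<in> {R1..R2}" for r z
    using strip_continuous_on_slice[OF ch order_refl, of z] that by (rule integral_has_real_derivative)
  have dz: "((\<lambda>s. ?\<psi> r s) has_real_derivative - (r * f r z)) (at z)" if r: "r \<in> {R1..R2}" for r z
  proof -
    have "((\<lambda>s. ?\<psi> r s) has_real_derivative integral {R1..r} (\<lambda>s. s * hz s z)) (at z)"
      by (rule strip_integral_has_derivative[OF ch chz])
        (use r in \<open>auto intro!: derivative_eq_intros strip_C1_has_derivative(2)[OF h]\<close>)
    moreover have "((\<lambda>s. s * hz s z) has_integral (- (r * f r z)) - (- (R1 * f R1 z))) {R1..r}"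
    proof (rule fundamental_theorem_of_calculus_interior)
      show "continuous_on {R1..r} (\<lambda>s. - (s * f s z))"
        by (rule strip_continuous_on_slice[OF cf]) (use r in auto)
      fix s assume s: "s \<in> {R1<..<r}"
      then have s': "s \<in> {R1<..<R2}" using r by auto
      have "((\<lambda>s. - (s * f s z)) has_real_derivative s * hz s z) (at s)"
        by (rule derivative_eq_intros strip_C1_has_derivative_interior[OF f s'] refl)+
          (use div[OF s', of z] in \<open>simp add: algebra_simps\<close>)
      then show "((\<lambda>s. - (s * f s z)) has_vector_derivative s * hz s z) (at s)"
        by (simp add: has_real_derivative_iff_has_vector_derivative)
    qed (use r in auto)
    ultimately show ?thesis using f0 by (simp add: integral_unique)
  qed
  have "continuous_on (strip R1 R2) (\<lambda>x. ?\<psi> (fst x) (snd x))"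
    using strip_continuous_on_partials[OF dr dz cf] .
  then show ?thesis using ch cf dr dz by (simp add: strip_C1_def)
qed

text \<open>The left-hand side is \<open>\<partial>\<^sub>r P + \<partial>\<^sub>z Q\<close>, written out, for
  \<open>P = \<nu> \<zeta> r (f f\<^sub>r + g g\<^sub>r + h h\<^sub>r) - q (r \<zeta> f - \<zeta>' \<psi>) - \<nu> \<zeta>' \<psi> (f\<^sub>r + f / r)\<close> and
  \<open>Q = \<nu> \<zeta> r (f f\<^sub>z + g g\<^sub>z + h h\<^sub>z) - q r \<zeta> h - \<nu> \<zeta>' \<psi> f\<^sub>z\<close>, where \<open>(f, g, h) = u\<close>.\<close>

lemma energy_identity:
  fixes r \<nu> :: real
  assumes r: "r \<noteq> 0"
    and e1: "f * fr + w * fz - (2 * V * g + g\<^sup>2) / r + qr = \<nu> * (frr + fr / r + fzz - f / r\<^sup>2)"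
    and e2: "f * (gr + V') + w * gz + f * (g + V) / r = \<nu> * (grr + gr / r + gzz - g / r\<^sup>2)"
    and e3: "f * (hr + W') + w * hz + qz = \<nu> * (hrr + hr / r + hzz)"
    and e4: "f + r * fr + r * hz = 0"
  shows "\<nu> * \<zeta> * ((fr * f + gr * g + hr * h)
        + r * (frr * f + fr\<^sup>2 + grr * g + gr\<^sup>2 + hrr * h + hr\<^sup>2))
      - qr * (r * \<zeta> * f - \<zeta>' * \<psi>) - q * (\<zeta> * f + r * \<zeta> * fr - \<zeta>' * (r * h))
      - \<nu> * \<zeta>' * (r * h) * (fr + f / r) - \<nu> * \<zeta>' * \<psi> * (frr + fr / r - f / r\<^sup>2)
      + (\<nu> * \<zeta>' * r * (fz * f + gz * g + hz * h)
        + \<nu> * \<zeta> * r * (fzz * f + fz\<^sup>2 + gzz * g + gz\<^sup>2 + hzz * h + hz\<^sup>2)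
      - qz * (r * \<zeta> * h) - q * (r * (\<zeta>' * h + \<zeta> * hz))
      - \<nu> * (\<zeta>'' * \<psi> - \<zeta>' * (r * f)) * fz - \<nu> * \<zeta>' * \<psi> * fzz)
    = (f * fr + w * fz - (2 * V * g + g\<^sup>2) / r) * (r * \<zeta> * f - \<zeta>' * \<psi>)
      + (f * (gr + V') + w * gz + f * (g + V) / r) * (r * \<zeta> * g)
      + (f * (hr + W') + w * hz) * (r * \<zeta> * h)
      + \<nu> * \<zeta> * (r * (fr\<^sup>2 + fz\<^sup>2 + gr\<^sup>2 + gz\<^sup>2 + hr\<^sup>2 + hz\<^sup>2) + (f\<^sup>2 + g\<^sup>2) / r)
      + (2 * \<nu> * \<zeta>' * r * f * fz + \<nu> * \<zeta>' * r * (g * gz + h * hz) - \<nu> * \<zeta>' * r * h * (fr + f / r) - \<nu> * \<zeta>'' * \<psi> * fz)"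
    (is "?l = ?r")
proof -
  define N1 N2 N3 where "N1 = f * fr + w * fz - (2 * V * g + g\<^sup>2) / r"
    and "N2 = f * (gr + V') + w * gz + f * (g + V) / r" and "N3 = f * (hr + W') + w * hz"
  \<comment> \<open>Writing \<open>i\<close> for \<open>1 / r\<close> makes the claim polynomial.
    The momentum equations eliminate \<open>qr\<close>, \<open>N2\<close> and \<open>qz\<close>; the
    terms with undifferentiated \<open>q\<close> combine to \<open>q * \<zeta>\<close> times the
    divergence \<open>e4\<close>.\<close>
  define i where "i = inverse r"
  have i: "i * r = 1" using r by (simp add: i_def)
  have qr: "qr = \<nu> * (frr + fr * i + fzz - f * i\<^sup>2) - N1" using e1 by (simp add: N1_def i_def divide_inverse power_inverse)
  have N2: "N2 = \<nu> * (grr + gr * i + gzz - g * i\<^sup>2)" using e2 by (simp add: N2_def i_def divide_inverse power_inverse)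
  have qz: "qz = \<nu> * (hrr + hr * i + hzz) - N3" using e3 by (simp add: N3_def i_def divide_inverse)
  show ?thesis
    unfolding N1_def[symmetric] N2_def[symmetric] N3_def[symmetric]
    unfolding divide_inverse power_inverse[symmetric] i_def[symmetric]
    unfolding qr qz N2
    using i e4 by algebra
qed

text \<open>With \<open>x = 1 - z\<^sup>2 / L\<^sup>2\<close> in \<open>[0, 1]\<close> and
  \<open>\<zeta> = x ^ 4\<close>, two derivatives still leave a factor
  \<open>x\<^sup>2 = \<phi>\<close>, the square root of \<open>\<zeta>\<close>; this is why the
  exponent is 4. The constants are \<open>8 = 4 * 2\<close> and \<open>56 = 48 + 8\<close>, and
  \<open>L \<ge> 1\<close> lets \<open>1 / L\<^sup>2\<close> be weakened to
  \<open>1 / L\<close>.\<close>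

lemma cutoff_bounds:
  fixes L z :: real
  assumes L: "L \<ge> 1" and z: "z \<in> {-L..L}"
  defines "\<phi> \<equiv> (1 - z\<^sup>2 / L\<^sup>2)\<^sup>2"
  shows "0 \<le> \<phi>" "(1 - z\<^sup>2 / L\<^sup>2) ^ 4 = \<phi>\<^sup>2"
    "\<bar>4 * (1 - z\<^sup>2 / L\<^sup>2) ^ 3 * (- 2 * z / L\<^sup>2)\<bar> \<le> 8 * \<phi> / L"
    "\<bar>12 * (1 - z\<^sup>2 / L\<^sup>2)\<^sup>2 * (- 2 * z / L\<^sup>2)\<^sup>2 + 4 * (1 - z\<^sup>2 / L\<^sup>2) ^ 3 * (- 2 / L\<^sup>2)\<bar> \<le> 56 * \<phi> / L"
proof -
  define x where "x = 1 - z\<^sup>2 / L\<^sup>2"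
  have "\<bar>z\<bar> \<le> L" using z by auto
  then have "z\<^sup>2 \<le> L\<^sup>2" by (metis abs_ge_zero power2_abs power_mono)
  then have x: "0 \<le> x" "x \<le> 1" using L by (auto simp: x_def)
  then have x3: "\<bar>x ^ 3\<bar> \<le> x\<^sup>2" by (simp add: power_decreasing)
  show "0 \<le> \<phi>" "(1 - z\<^sup>2 / L\<^sup>2) ^ 4 = \<phi>\<^sup>2" by (simp_all add: \<phi>_def)
  have zL: "\<bar>z\<bar> / L\<^sup>2 \<le> 1 / L" using \<open>\<bar>z\<bar> \<le> L\<close> L by (simp add: field_simps power2_eq_square)
  have "\<bar>4 * x ^ 3 * (- 2 * z / L\<^sup>2)\<bar> = 8 * (\<bar>x ^ 3\<bar> * (\<bar>z\<bar> / L\<^sup>2))" by (simp add: abs_mult)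
  also have "\<dots> \<le> 8 * (x\<^sup>2 * (1 / L))" using x3 zL L by (intro mult_left_mono mult_mono) auto
  finally show "\<bar>4 * (1 - z\<^sup>2 / L\<^sup>2) ^ 3 * (- 2 * z / L\<^sup>2)\<bar> \<le> 8 * \<phi> / L" by (simp add: \<phi>_def x_def)
  have L2: "1 / L\<^sup>2 \<le> 1 / L" "1 / L \<le> 1" using L by (auto simp: field_simps power2_eq_square)
  have "(\<bar>z\<bar> / L\<^sup>2)\<^sup>2 \<le> (1 / L)\<^sup>2" using zL by (intro power_mono) auto
  also have "\<dots> \<le> 1 / L" using L2 by (simp add: power_divide)
  finally have "48 * (x\<^sup>2 * (\<bar>z\<bar> / L\<^sup>2)\<^sup>2) \<le> 48 * (x\<^sup>2 * (1 / L))"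
    by (intro mult_left_mono) auto
  moreover have "\<bar>12 * x\<^sup>2 * (- 2 * z / L\<^sup>2)\<^sup>2\<bar> = 48 * (x\<^sup>2 * (\<bar>z\<bar> / L\<^sup>2)\<^sup>2)"
    by (simp add: power_mult_distrib power_divide)
  ultimately have 1: "\<bar>12 * x\<^sup>2 * (- 2 * z / L\<^sup>2)\<^sup>2\<bar> \<le> 48 * (x\<^sup>2 * (1 / L))"
    by linarith
  have "\<bar>4 * x ^ 3 * (- 2 / L\<^sup>2)\<bar> = 8 * (\<bar>x ^ 3\<bar> * (1 / L\<^sup>2))" by (simp add: abs_mult)
  also have "\<dots> \<le> 8 * (x\<^sup>2 * (1 / L))" using x3 L2 by (intro mult_left_mono mult_mono) auto
  finally have "\<bar>12 * x\<^sup>2 * (- 2 * z / L\<^sup>2)\<^sup>2 + 4 * x ^ 3 * (- 2 / L\<^sup>2)\<bar> \<le> 56 * (x\<^sup>2 * (1 / L))"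
    using 1 by linarith
  then show "\<bar>12 * (1 - z\<^sup>2 / L\<^sup>2)\<^sup>2 * (- 2 * z / L\<^sup>2)\<^sup>2 + 4 * (1 - z\<^sup>2 / L\<^sup>2) ^ 3 * (- 2 / L\<^sup>2)\<bar> \<le> 56 * \<phi> / L"
    by (simp add: \<phi>_def x_def)
qed

subsection \<open>Vanishing of the perturbation\<close>

lemma cutoff_has_derivative:
  fixes L z :: real
  shows "((\<lambda>z. (1 - z\<^sup>2 / L\<^sup>2) ^ 4) has_real_derivative 4 * (1 - z\<^sup>2 / L\<^sup>2) ^ 3 * (- 2 * z / L\<^sup>2)) (at z)"
    and "((\<lambda>z. 4 * (1 - z\<^sup>2 / L\<^sup>2) ^ 3 * (- 2 * z / L\<^sup>2)) has_real_derivative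
      12 * (1 - z\<^sup>2 / L\<^sup>2)\<^sup>2 * (- 2 * z / L\<^sup>2)\<^sup>2 + 4 * (1 - z\<^sup>2 / L\<^sup>2) ^ 3 * (- 2 / L\<^sup>2)) (at z)"
proof -
  have x: "((\<lambda>z. 1 - z\<^sup>2 / L\<^sup>2) has_real_derivative - 2 * z / L\<^sup>2) (at z)"
    using DERIV_diff[OF DERIV_const[of 1] DERIV_cdivide[OF DERIV_power[OF DERIV_ident, of 2], of "L\<^sup>2"]] by simp
  have y: "((\<lambda>z. - 2 * z / L\<^sup>2) has_real_derivative - 2 / L\<^sup>2) (at z)"
    using DERIV_cdivide[OF DERIV_cmult[OF DERIV_ident, of "- 2"], of "L\<^sup>2"] by simp
  show "((\<lambda>z. (1 - z\<^sup>2 / L\<^sup>2) ^ 4) has_real_derivative 4 * (1 - z\<^sup>2 / L\<^sup>2) ^ 3 * (- 2 * z / L\<^sup>2)) (at z)"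
    using DERIV_power[OF x, of 4] by (simp add: mult_ac)
  show "((\<lambda>z. 4 * (1 - z\<^sup>2 / L\<^sup>2) ^ 3 * (- 2 * z / L\<^sup>2)) has_real_derivative
      12 * (1 - z\<^sup>2 / L\<^sup>2)\<^sup>2 * (- 2 * z / L\<^sup>2)\<^sup>2 + 4 * (1 - z\<^sup>2 / L\<^sup>2) ^ 3 * (- 2 / L\<^sup>2)) (at z)"
    using DERIV_mult[OF DERIV_cmult[OF DERIV_power[OF x, of 3], of 4] y]
    by (simp only: power2_eq_square[of "- 2 * z / L\<^sup>2"]) (simp add: mult_ac)
qed

text \<open>Integrating the energy identity across the gap and using
  \<open>energy_density_coercive\<close> at each radius gives the hypotheses of
  \<open>exhausting_cutoff_vanish\<close>. Here \<open>(f, g, h)\<close> is \<open>u\<close>,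
  \<open>w\<close> the full axial velocity and \<open>q\<close> the pressure less that of the base
  flow. Only \<open>\<epsilon>\<close> has to be small: \<open>M\<close> enters just the remainder
  that tends to 0.\<close>

lemma perturbation_vanishes:
  fixes f g h \<psi> q w :: "real \<Rightarrow> real \<Rightarrow> real" and V V' W' :: "real \<Rightarrow> real"
  assumes R: "0 < R1" "R1 < R2" "\<nu> > 0"
    and f: "strip_C1 R1 R2 f fr fz" "strip_C1 R1 R2 fr frr frz" "strip_C1 R1 R2 fz fzr fzz"
    and g: "strip_C1 R1 R2 g gr gz" "strip_C1 R1 R2 gr grr grz" "strip_C1 R1 R2 gz gzr gzz"
    and h: "strip_C1 R1 R2 h hr hz" "strip_C1 R1 R2 hr hrr hrz" "strip_C1 R1 R2 hz hzr hzz"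
    and \<psi>: "strip_C1 R1 R2 \<psi> (\<lambda>r z. r * h r z) (\<lambda>r z. - (r * f r z))"
    and q: "strip_C1 R1 R2 q qr qz"
    and bc: "\<And>r z. r \<in> {R1, R2} \<Longrightarrow> f r z = 0 \<and> g r z = 0 \<and> h r z = 0 \<and> \<psi> r z = 0"
    and e1: "\<And>r z. r \<in> {R1<..<R2} \<Longrightarrow> f r z * fr r z + w r z * fz r z - (2 * V r * g r z + (g r z)\<^sup>2) / r + qr r z
        = \<nu> * (frr r z + fr r z / r + fzz r z - f r z / r\<^sup>2)"
    and e2: "\<And>r z. r \<in> {R1<..<R2} \<Longrightarrow> f r z * (gr r z + V' r) + w r z * gz r z + f r z * (g r z + V r) / r
        = \<nu> * (grr r z + gr r z / r + gzz r z - g r z / r\<^sup>2)"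
    and e3: "\<And>r z. r \<in> {R1<..<R2} \<Longrightarrow> f r z * (hr r z + W' r) + w r z * hz r z + qz r z
        = \<nu> * (hrr r z + hr r z / r + hzz r z)"
    and e4: "\<And>r z. r \<in> {R1<..<R2} \<Longrightarrow> f r z + r * fr r z + r * hz r z = 0"
    and eps: "\<epsilon> \<le> 1" "\<epsilon> * (2 * R2 + 3) \<le> min (\<nu> * R1 / 2) (\<nu> * R1 / (4 * (R2 - R1)\<^sup>2) / 2) / 4"
    and small: "\<And>r z. r \<in> {R1<..<R2} \<Longrightarrow> \<bar>f r z\<bar> \<le> \<epsilon>" "\<And>r z. r \<in> {R1<..<R2} \<Longrightarrow> \<bar>g r z\<bar> \<le> \<epsilon>"
      "\<And>r z. r \<in> {R1<..<R2} \<Longrightarrow> \<bar>w r z\<bar> \<le> \<epsilon>" "\<And>r. r \<in> {R1<..<R2} \<Longrightarrow> \<bar>V r\<bar> \<le> \<epsilon>"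
      "\<And>r. r \<in> {R1<..<R2} \<Longrightarrow> \<bar>V' r\<bar> \<le> \<epsilon>" "\<And>r. r \<in> {R1<..<R2} \<Longrightarrow> \<bar>W' r\<bar> \<le> \<epsilon>"
    and bdd: "\<And>r z. r \<in> {R1<..<R2} \<Longrightarrow> \<bar>f r z\<bar> \<le> M" "\<And>r z. r \<in> {R1<..<R2} \<Longrightarrow> \<bar>g r z\<bar> \<le> M"
      "\<And>r z. r \<in> {R1<..<R2} \<Longrightarrow> \<bar>h r z\<bar> \<le> M" "\<And>r z. r \<in> {R1<..<R2} \<Longrightarrow> \<bar>\<psi> r z\<bar> \<le> M"
    and r: "r \<in> {R1..R2}"
  shows "f r z = 0 \<and> g r z = 0 \<and> h r z = 0"
proof -
  define \<kappa> where "\<kappa> = \<nu> * R1 / (4 * (R2 - R1)\<^sup>2)"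
  define c where "c = min (\<nu> * R1 / 2) (\<kappa> / 2)"
  define K where "K = 6 * (M * (8 + 24 / R1 + 16 * \<nu> * R2 + 64 * \<nu>))\<^sup>2 / c"
  define Z where "Z L z = (1 - z\<^sup>2 / L\<^sup>2) ^ 4" for L z :: real
  define Z1 where "Z1 L z = 4 * (1 - z\<^sup>2 / L\<^sup>2) ^ 3 * (- 2 * z / L\<^sup>2)" for L z :: real
  define Z2 where "Z2 L z = 12 * (1 - z\<^sup>2 / L\<^sup>2)\<^sup>2 * (- 2 * z / L\<^sup>2)\<^sup>2 + 4 * (1 - z\<^sup>2 / L\<^sup>2) ^ 3 * (- 2 / L\<^sup>2)" for L z :: real
  define D where "D r z = (fr r z)\<^sup>2 + (fz r z)\<^sup>2 + (gr r z)\<^sup>2 + (gz r z)\<^sup>2 + (hr r z)\<^sup>2 + (hz r z)\<^sup>2" for r z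
  define E where "E z = integral {R1..R2} (\<lambda>r. D r z)" for z
  \<comment> \<open>\<open>Q\<close> and \<open>P\<close> are the axial and radial energy fluxes,
    with derivatives \<open>Qz\<close> and \<open>Pr\<close> as in \<open>energy_identity\<close>.
    \<open>P\<close> contains in addition the Poincare flux
    \<open>\<kappa> * \<zeta> * (r - R2) * |u|\<^sup>2\<close>; its derivative is left out of
    \<open>Pr\<close> and becomes \<open>?U\<close> below.\<close>
  define Q where "Q L r z = \<nu> * Z L z * r * (fz r z * f r z + gz r z * g r z + hz r z * h r z)
      - q r z * (r * Z L z * h r z) - \<nu> * Z1 L z * \<psi> r z * fz r z" for L r z
  define Qz where "Qz L r z = \<nu> * Z1 L z * r * (fz r z * f r z + gz r z * g r z + hz r z * h r z)
        + \<nu> * Z L z * r * (fzz r z * f r z + (fz r z)\<^sup>2 + gzz r z * g r z + (gz r z)\<^sup>2 + hzz r z * h r z + (hz r z)\<^sup>2)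
      - qz r z * (r * Z L z * h r z) - q r z * (r * (Z1 L z * h r z + Z L z * hz r z))
      - \<nu> * (Z2 L z * \<psi> r z - Z1 L z * (r * f r z)) * fz r z - \<nu> * Z1 L z * \<psi> r z * fzz r z" for L r z
  define P where "P L z r = \<nu> * Z L z * r * (fr r z * f r z + gr r z * g r z + hr r z * h r z)
      - q r z * (r * Z L z * f r z - Z1 L z * \<psi> r z) - \<nu> * Z1 L z * \<psi> r z * (fr r z + f r z / r)
      + \<kappa> * Z L z * (r - R2) * ((f r z)\<^sup>2 + (g r z)\<^sup>2 + (h r z)\<^sup>2)" for L z r
  define Pr where "Pr L z r = \<nu> * Z L z * ((fr r z * f r z + gr r z * g r z + hr r z * h r z)
        + r * (frr r z * f r z + (fr r z)\<^sup>2 + grr r z * g r z + (gr r z)\<^sup>2 + hrr r z * h r z + (hr r z)\<^sup>2))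
      - qr r z * (r * Z L z * f r z - Z1 L z * \<psi> r z)
      - q r z * (Z L z * f r z + r * Z L z * fr r z - Z1 L z * (r * h r z))
      - \<nu> * Z1 L z * (r * h r z) * (fr r z + f r z / r)
      - \<nu> * Z1 L z * \<psi> r z * (frr r z + fr r z / r - f r z / r\<^sup>2)" for L z r
  note cont = f(1-3)[THEN strip_C1_continuous_on(1)] g(1-3)[THEN strip_C1_continuous_on(1)]
    h(1-3)[THEN strip_C1_continuous_on(1)] strip_C1_continuous_on(1)[OF \<psi>] strip_C1_continuous_on(1)[OF q]
    f(2)[THEN strip_C1_continuous_on(2)] f(3)[THEN strip_C1_continuous_on(3)]
    g(2)[THEN strip_C1_continuous_on(2)] g(3)[THEN strip_C1_continuous_on(3)]
    h(2)[THEN strip_C1_continuous_on(2)] h(3)[THEN strip_C1_continuous_on(3)]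
    strip_C1_continuous_on(2)[OF q] strip_C1_continuous_on(3)[OF q]
  note slice = cont[THEN strip_continuous_on_slice, OF order_refl]
  have contD: "continuous_on (strip R1 R2) (\<lambda>x. D (fst x) (snd x))"
    unfolding D_def by (intro continuous_intros cont)
  have D0: "0 \<le> D r z" for r z by (simp add: D_def)
  have cpos: "c > 0" using R by (simp add: c_def \<kappa>_def)
  have ZC: "(Z L has_real_derivative Z1 L z) (at z)" "(Z1 L has_real_derivative Z2 L z) (at z)"
    for L z
    unfolding Z_def[abs_def] Z1_def[abs_def] Z2_def by (rule cutoff_has_derivative)+
  have Zcont: "continuous_on S (\<lambda>x. Z L (snd x))" "continuous_on S (\<lambda>x. Z1 L (snd x))" "continuous_on S (\<lambda>x. Z2 L (snd x))"
    if "L \<ge> 1" for L and S :: "(real \<times> real) set"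
    unfolding Z_def Z1_def Z2_def using that by (intro continuous_intros; simp)+
  have contQ: "continuous_on (strip R1 R2) (\<lambda>x. Q L (fst x) (snd x))"
    and contQz: "continuous_on (strip R1 R2) (\<lambda>x. Qz L (fst x) (snd x))" if "L \<ge> 1" for L
    unfolding Q_def Qz_def by (intro continuous_intros cont Zcont[OF that])+
  have dQ: "((\<lambda>z. Q L r z) has_real_derivative Qz L r z) (at z)" if "L \<ge> 1" and r: "r \<in> {R1..R2}" for L r z
    unfolding Q_def[abs_def]
    by (rule derivative_eq_intros refl ZC strip_C1_has_derivative(2)[OF \<psi> r]
        strip_C1_has_derivative(2)[OF q r]
        f(1,3)[THEN strip_C1_has_derivative(2), OF r] g(1,3)[THEN strip_C1_has_derivative(2), OF r]
        h(1,3)[THEN strip_C1_has_derivative(2), OF r])+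
      (simp add: Qz_def algebra_simps power2_eq_square)
  have dP: "(P L z has_real_derivative Pr L z r
      + (\<kappa> * Z L z * ((f r z)\<^sup>2 + (g r z)\<^sup>2 + (h r z)\<^sup>2)
        + 2 * \<kappa> * Z L z * (r - R2) * (f r z * fr r z + g r z * gr r z + h r z * hr r z))) (at r)"
    if r: "r \<in> {R1<..<R2}" for L z r
  proof -
    have "((\<lambda>r. fr r z + f r z / r) has_real_derivative frr r z + fr r z / r - f r z / r\<^sup>2) (at r)"
      using DERIV_add[OF strip_C1_has_derivative_interior[OF f(2) r, of z]
          DERIV_divide[OF strip_C1_has_derivative_interior[OF f(1) r, of z] DERIV_ident]] r R
      by (simp add: diff_divide_distrib add_diff_eq power2_eq_square)
    note d = this f(1,2)[THEN strip_C1_has_derivative_interior, OF r]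
      g(1,2)[THEN strip_C1_has_derivative_interior, OF r] h(1,2)[THEN strip_C1_has_derivative_interior, OF r]
      strip_C1_has_derivative_interior[OF \<psi> r] strip_C1_has_derivative_interior[OF q r]
    show ?thesis
      unfolding P_def[abs_def]
      by (rule d refl derivative_eq_intros)+
        (simp add: Pr_def algebra_simps power2_eq_square)
  qed
  have E0: "E z = 0" for z
  proof (rule exhausting_cutoff_vanish[where E = E and G = "\<lambda>L z. integral {R1..R2} (\<lambda>r. Q L r z)"
        and G' = "\<lambda>L z. integral {R1..R2} (\<lambda>r. Qz L r z)" and c = "c / 2" and C = "K * (R2 - R1)"])
    show "continuous_on UNIV E" unfolding E_def[abs_def] by (rule strip_integral_continuous_on[OF contD])
    have intD: "(\<lambda>r. D r z) integrable_on {R1..R2}" for z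
      by (intro integrable_continuous_interval strip_continuous_on_slice[OF contD]) auto
    show "0 \<le> E z" for z unfolding E_def using D0 intD by (intro integral_nonneg)
    show "0 < c / 2" using cpos by simp
    fix L :: real assume L: "L \<ge> 1"
    show "((\<lambda>z. integral {R1..R2} (\<lambda>r. Q L r z)) has_real_derivative integral {R1..R2} (\<lambda>r. Qz L r z)) (at z)" for z
      by (rule strip_integral_has_derivative[OF contQ[OF L] contQz[OF L] dQ[OF L]]) auto
    \<comment> \<open>Both \<open>Z\<close> and \<open>Z1\<close> vanish at \<open>L\<close> and at
      \<open>- L\<close>, so both sides are 0.\<close>
    show "integral {R1..R2} (\<lambda>r. Q L r L) = integral {R1..R2} (\<lambda>r. Q L r (- L))"
      using L by (simp add: Q_def Z_def Z1_def)
    fix z assume z: "z \<in> {-L..L}"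
    let ?U = "\<lambda>r. \<kappa> * Z L z * ((f r z)\<^sup>2 + (g r z)\<^sup>2 + (h r z)\<^sup>2)
        + 2 * \<kappa> * Z L z * (r - R2) * (f r z * fr r z + g r z * gr r z + h r z * hr r z)"
    \<comment> \<open>The radial flux contributes nothing: every term of \<open>P\<close> has a
      factor \<open>f\<close>, \<open>g\<close>, \<open>h\<close> or \<open>\<psi>\<close>, all zero
      on the walls.\<close>
    have "((\<lambda>r. Pr L z r + ?U r) has_integral P L z R2 - P L z R1) {R1..R2}"
    proof (rule fundamental_theorem_of_calculus_interior)
      show "continuous_on {R1..R2} (P L z)"
        unfolding P_def[abs_def] using R by (intro continuous_intros slice) auto
    qed (use R dP in \<open>auto simp flip: has_real_derivative_iff_has_vector_derivative\<close>)
    then have "((\<lambda>r. Pr L z r + ?U r) has_integral 0) {R1..R2}"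
      using bc by (simp add: P_def)
    moreover have "(\<lambda>r. Qz L r z) integrable_on {R1..R2}"
      by (intro integrable_continuous_interval strip_continuous_on_slice[OF contQz[OF L]]) auto
    ultimately have up: "((\<lambda>r. Pr L z r + ?U r + Qz L r z) has_integral 0 + integral {R1..R2} (\<lambda>r. Qz L r z)) {R1..R2}"
      by (intro has_integral_add integrable_integral)
    have lo: "((\<lambda>r. c / 2 * Z L z * D r z - K / L\<^sup>2) has_integral c / 2 * Z L z * E z - (R2 - R1) * (K / L\<^sup>2)) {R1..R2}"
      using has_integral_const_real[of "K / L\<^sup>2" R1 R2] R unfolding E_def
      by (intro has_integral_diff has_integral_mult_right integrable_integral intD) auto
    have "c / 2 * Z L z * E z - (R2 - R1) * (K / L\<^sup>2) \<le> 0 + integral {R1..R2} (\<lambda>r. Qz L r z)"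
    \<comment> \<open>Passing to the open interval matters, since the differential equations are
      given only at interior radii.\<close>
    proof (rule has_integral_le[OF lo[unfolded has_integral_Icc_iff_Ioo] up[unfolded has_integral_Icc_iff_Ioo]])
      fix r assume r: "r \<in> {R1<..<R2}"
      have sum: "x \<le> p + (a + b) + q" if "x \<le> t + a + b" "p + q = t" for x p a b q t :: real
        using that by linarith
      from r have r': "R1 \<le> r" "r \<le> R2" "r \<noteq> 0" using R by auto
      note eid = energy_identity[OF r'(3) e1[OF r, of z] e2[OF r, of z] e3[OF r, of z] e4[OF r, of z],
          where \<zeta> = "Z L z" and \<zeta>' = "Z1 L z" and \<zeta>'' = "Z2 L z" and \<psi> = "\<psi> r z" and q = "q r z" and h = "h r z"]
      note cf = cutoff_bounds[OF L z, folded Z_def Z1_def Z2_def]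
      note co = energy_density_coercive[OF R(1,2) r'(1,2) R(3) L cf(1) \<kappa>_def c_def
          eps(1) eps(2)[folded \<kappa>_def, folded c_def]
          small(1)[OF r, of z] small(2)[OF r, of z] small(3)[OF r, of z] small(4)[OF r] small(5)[OF r] small(6)[OF r]
          bdd(1)[OF r, of z] bdd(2)[OF r, of z] bdd(3)[OF r, of z] bdd(4)[OF r, of z] cf(2-4),
          where fr = "fr r z" and fz = "fz r z" and gr = "gr r z" and gz = "gz r z" and hr = "hr r z" and hz = "hz r z",
          folded D_def K_def]
      show "c / 2 * Z L z * D r z - K / L\<^sup>2 \<le> Pr L z r + ?U r + Qz L r z"
        by (rule sum[OF co eid[folded Pr_def Qz_def D_def]])
    qed
    then show "c / 2 * (1 - z\<^sup>2 / L\<^sup>2) ^ 4 * E z - K * (R2 - R1) / L\<^sup>2 \<le> integral {R1..R2} (\<lambda>r. Qz L r z)"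
      by (simp add: Z_def mult.commute)
  qed
  \<comment> \<open>\<open>D\<close> is continuous and nonnegative, so its zero integral makes it
    vanish pointwise; \<open>u\<close> is then constant in \<open>r\<close> and takes its value 0
    from the inner wall.\<close>
  have D00: "D r z = 0" if "r \<in> {R1..R2}" for r z
    using integral_eq_0_iff[OF strip_continuous_on_slice[OF contD order_refl, of z] R(2)] D0 E0[of z] that
    by (auto simp: E_def)
  have const: "u r z = 0" if u: "strip_C1 R1 R2 u ur uz" and u0: "u R1 z = 0" and ur: "\<And>r. r \<in> {R1..R2} \<Longrightarrow> ur r z = 0"
    for u ur uz z
  proof (cases "r = R1")
    case False
    then have rr: "R1 < r" using r by auto
    have "u r z = u R1 z"
    proof (rule DERIV_isconst_end[OF rr])
      show "continuous_on {R1..r} (\<lambda>r. u r z)"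
        by (rule strip_continuous_on_slice[OF strip_C1_continuous_on(1)[OF u]]) (use r in auto)
      show "((\<lambda>r. u r z) has_real_derivative 0) (at x)" if "R1 < x" "x < r" for x
        using strip_C1_has_derivative_interior[OF u, of x z] ur[of x] that r by auto
    qed
    then show ?thesis using u0 by simp
  qed (use u0 in simp)
  have z0: "fr r z = 0" "gr r z = 0" "hr r z = 0" if "r \<in> {R1..R2}" for r
    using D00[OF that, of z] unfolding D_def by (simp_all add: add_nonneg_eq_0_iff)
  show ?thesis
    using const[OF f(1), of z] const[OF g(1), of z] const[OF h(1), of z] bc[of R1 z] z0 by auto
qed

section \<open>Partial derivatives of differences, radial and axial functions, and vanishing
  fields\<close>

lemma strip_C1_diff:
  assumes "strip_C1 R1 R2 f fr fz" "strip_C1 R1 R2 g gr gz"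
  shows "strip_C1 R1 R2 (\<lambda>r z. f r z - g r z) (\<lambda>r z. fr r z - gr r z) (\<lambda>r z. fz r z - gz r z)"
  using assms unfolding strip_C1_def by (auto intro!: continuous_on_diff DERIV_diff)

lemma strip_C1_radial:
  assumes "\<And>r. r \<in> {R1..R2} \<Longrightarrow> (u has_real_derivative u' r) (at r within {R1..R2})"
    and "continuous_on {R1..R2} u'"
  shows "strip_C1 R1 R2 (\<lambda>r z. u r) (\<lambda>r z. u' r) (\<lambda>r z. 0)"
proof -
  have c: "continuous_on (strip R1 R2) (\<lambda>x. v (fst x))" if "continuous_on {R1..R2} v" for v :: "real \<Rightarrow> real"
    by (rule continuous_on_compose2[OF that]) (auto simp: strip_def intro!: continuous_intros)
  have "continuous_on {R1..R2} u" using assms(1) by (rule DERIV_continuous_on)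
  then show ?thesis using assms c by (simp add: strip_C1_def)
qed

lemma strip_C1_const: "strip_C1 R1 R2 (\<lambda>r z. c) (\<lambda>r z. 0) (\<lambda>r z. 0)"
  by (rule strip_C1_radial) auto

lemma strip_C1_axial: "strip_C1 R1 R2 (\<lambda>r z. a * z) (\<lambda>r z. 0) (\<lambda>r z. a)"
  by (auto simp: strip_C1_def intro!: continuous_intros derivative_eq_intros)

lemma strip_C1_vanishing:
  assumes u: "strip_C1 R1 R2 u ur uz" and zero: "\<And>r z. r \<in> {R1<..<R2} \<Longrightarrow> u r z = 0"
    and r: "r \<in> {R1<..<R2}"
  shows "ur r z = 0" "uz r z = 0"
proof -
  have "((\<lambda>s. 0) has_real_derivative ur r z) (at r)"
    using strip_C1_has_derivative_interior[OF u r, of z]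
    by (rule DERIV_cong_ev[OF refl _ refl, THEN iffD1, rotated])
      (use r zero in \<open>auto intro!: eventually_mono[OF eventually_nhds_in_open[of "{R1<..<R2}" r]]\<close>)
  then show "ur r z = 0" using DERIV_unique DERIV_const by blast
  have "((\<lambda>s. 0) has_real_derivative uz r z) (at z)"
    using strip_C1_has_derivative(2)[OF u, of r z] zero[OF r] r by auto
  then show "uz r z = 0" using DERIV_unique DERIV_const by blast
qed

subsection \<open>Supremum bound from the essential supremum\<close>

text \<open>The frame \<open>e_r\<close>, \<open>e_\<theta>\<close>, \<open>e_z\<close> is
  orthonormal at every angle, so the branch of \<open>Arg\<close> drops out of the norm.\<close>

lemma norm_cyl_field:
  "norm (cyl_field vr v\<theta> vz x) = sqrt ((vr (sqrt ((x $ 1)\<^sup>2 + (x $ 2)\<^sup>2)) (x $ 3))\<^sup>2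
     + (v\<theta> (sqrt ((x $ 1)\<^sup>2 + (x $ 2)\<^sup>2)) (x $ 3))\<^sup>2 + (vz (sqrt ((x $ 1)\<^sup>2 + (x $ 2)\<^sup>2)) (x $ 3))\<^sup>2)"
proof -
  have "(a * c - b * s)\<^sup>2 + (a * s + b * c)\<^sup>2 + d\<^sup>2 = (a\<^sup>2 + b\<^sup>2) * (s\<^sup>2 + c\<^sup>2) + d\<^sup>2" for a b c d s :: real
    by (simp add: power2_eq_square algebra_simps)
  then have "(a * cos t - b * sin t)\<^sup>2 + (a * sin t + b * cos t)\<^sup>2 + d\<^sup>2 = a\<^sup>2 + b\<^sup>2 + d\<^sup>2" for a b d t :: real
    by simp
  then show ?thesis
    by (simp add: cyl_field_def Let_def norm_eq_sqrt_inner inner_vec_def sum_3 e_r_def e_\<theta>_def e_z_def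
        flip: power2_eq_square)
qed

text \<open>The norm of the field is continuous on the open domain, so the set where it exceeds
  \<open>C\<close> is open. The essential bound makes that set negligible, hence empty. A point with
  angle 0 then represents any given \<open>(r, z)\<close>.\<close>

lemma Linfty_norm_less_imp_bounded:
  assumes "0 \<le> R1"
    and c: "continuous_on (strip R1 R2) (\<lambda>x. vr (fst x) (snd x))"
      "continuous_on (strip R1 R2) (\<lambda>x. v\<theta> (fst x) (snd x))"
      "continuous_on (strip R1 R2) (\<lambda>x. vz (fst x) (snd x))"
    and less: "Linfty_norm (cyl_domain R1 R2) (cyl_field vr v\<theta> vz) < ereal C"
    and r: "r \<in> {R1<..<R2}"
  shows "\<bar>vr r z\<bar> \<le> C" "\<bar>v\<theta> r z\<bar> \<le> C" "\<bar>vz r z\<bar> \<le> C"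
proof -
  let ?D = "cyl_domain R1 R2"
  let ?N = "\<lambda>x. norm (cyl_field vr v\<theta> vz x)"
  let ?B = "{x \<in> ?D. ?N x \<in> {C<..}}"
  have Dop: "open ?D"
    unfolding cyl_domain_def by (intro open_Collect_conj open_Collect_less continuous_intros)
  have proj: "continuous_on ?D (\<lambda>x. u (sqrt ((x $ 1)\<^sup>2 + (x $ 2)\<^sup>2)) (x $ 3))"
    if "continuous_on (strip R1 R2) (\<lambda>x. u (fst x) (snd x))" for u :: "real \<Rightarrow> real \<Rightarrow> real"
  proof -
    have "continuous_on ?D (\<lambda>x. (\<lambda>x. u (fst x) (snd x)) (sqrt ((x $ 1)\<^sup>2 + (x $ 2)\<^sup>2), x $ 3))"
      by (rule continuous_on_compose2[OF that])
        (auto simp: strip_def cyl_domain_def intro!: continuous_intros)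
    then show ?thesis by simp
  qed
  have Ncont: "continuous_on ?D ?N"
    unfolding norm_cyl_field by (intro continuous_intros proj c)
  have Bop: "open ?B"
    using continuous_open_preimage[OF Ncont Dop, of "{C<..}"] by (simp add: vimage_def Int_def)
  have Dsets: "?D \<in> sets lebesgue" using Dop by (simp add: borel_open)
  have "AE x in lebesgue_on ?D. ereal (?N x) \<le> Linfty_norm ?D (cyl_field vr v\<theta> vz)"
    unfolding Linfty_norm_def by (rule esssup_AE)
  then have "AE x in lebesgue_on ?D. ?N x < C"
    using less by (auto elim!: eventually_mono dest: le_less_trans)
  then have "AE x in lebesgue. x \<in> ?D \<longrightarrow> ?N x < C"
    using Dsets by (simp add: AE_restrict_space_iff)
  then have "AE x in lebesgue. x \<notin> ?B" by eventually_elim auto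
  moreover have "?B \<in> sets lebesgue" using Bop by (simp add: borel_open)
  ultimately have "negligible ?B"
    using AE_iff_null_sets negligible_iff_null_sets by blast
  then have B0: "?B = {}" using open_not_negligible[OF Bop] by blast
  define x :: "real ^ 3" where "x = vector [r, 0, z]"
  have x: "sqrt ((x $ 1)\<^sup>2 + (x $ 2)\<^sup>2) = r" "x $ 3 = z"
    using r assms(1) by (auto simp: x_def)
  then have "x \<in> ?D" using r by (simp add: cyl_domain_def)
  then have N: "?N x \<le> C" using B0 by (auto simp: not_less)
  then have le: "(vr r z)\<^sup>2 + (v\<theta> r z)\<^sup>2 + (vz r z)\<^sup>2 \<le> C\<^sup>2"
    unfolding norm_cyl_field x by (simp add: sqrt_le_D)
  have C: "0 \<le> C" using order_trans[OF norm_ge_zero N] .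
  have sq: "(vr r z)\<^sup>2 \<le> C\<^sup>2" "(v\<theta> r z)\<^sup>2 \<le> C\<^sup>2" "(vz r z)\<^sup>2 \<le> C\<^sup>2"
    using le zero_le_power2[of "vr r z"] zero_le_power2[of "v\<theta> r z"] zero_le_power2[of "vz r z"]
    by linarith+
  show "\<bar>vr r z\<bar> \<le> C" "\<bar>v\<theta> r z\<bar> \<le> C" "\<bar>vz r z\<bar> \<le> C"
    using sq C by (simp_all add: abs_le_square_iff[symmetric])
qed

subsection \<open>Couette and Poiseuille profiles\<close>

text \<open>Clearing the quotient \<open>\<omega>2 / \<omega>1\<close> merges the two cases of the
  definition into one expression, linear in the angular velocities.\<close>

lemma couette_A_eq:
  assumes "0 < R1" "R1 < R2"
  shows "couette_A R1 R2 \<omega>1 \<omega>2 = (R2\<^sup>2 * \<omega>2 - R1\<^sup>2 * \<omega>1) / (R2\<^sup>2 - R1\<^sup>2)"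
proof -
  have "R1\<^sup>2 < R2\<^sup>2" using assms by (intro power_strict_mono) auto
  then have eta: "1 - (R1 / R2)\<^sup>2 = (R2\<^sup>2 - R1\<^sup>2) / R2\<^sup>2" and R2: "R2\<^sup>2 \<noteq> 0"
    using assms by (simp_all add: field_simps)
  have "(\<omega>2 / \<omega>1 - (R1 / R2)\<^sup>2) * R2\<^sup>2 * \<omega>1 = R2\<^sup>2 * \<omega>2 - R1\<^sup>2 * \<omega>1" if "\<omega>1 \<noteq> 0"
    using that R2 by (simp add: field_simps)
  then show ?thesis
    using R2 by (simp add: couette_A_def \<eta>_ratio_def \<mu>_ratio_def Let_def eta)
qed

lemma couette_B_eq:
  assumes "0 < R1" "R1 < R2"
  shows "couette_B R1 R2 \<omega>1 \<omega>2 = R1\<^sup>2 * R2\<^sup>2 * (\<omega>1 - \<omega>2) / (R2\<^sup>2 - R1\<^sup>2)"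
proof -
  have "R1\<^sup>2 < R2\<^sup>2" using assms by (intro power_strict_mono) auto
  moreover have "1 - (R1 / R2)\<^sup>2 = (R2\<^sup>2 - R1\<^sup>2) / R2\<^sup>2" using assms by (simp add: field_simps)
  ultimately show ?thesis
    using assms by (simp add: couette_B_def \<eta>_ratio_def \<mu>_ratio_def Let_def field_simps)
qed

lemma couette_boundary_values:
  assumes "0 < R1" "R1 < R2"
  shows "couette_A R1 R2 \<omega>1 \<omega>2 * R1 + couette_B R1 R2 \<omega>1 \<omega>2 * (1 / R1) = R1 * \<omega>1"
    and "couette_A R1 R2 \<omega>1 \<omega>2 * R2 + couette_B R1 R2 \<omega>1 \<omega>2 * (1 / R2) = R2 * \<omega>2"
proof -
  have "R1\<^sup>2 < R2\<^sup>2" using assms by (intro power_strict_mono) auto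
  then show "couette_A R1 R2 \<omega>1 \<omega>2 * R1 + couette_B R1 R2 \<omega>1 \<omega>2 * (1 / R1) = R1 * \<omega>1"
    and "couette_A R1 R2 \<omega>1 \<omega>2 * R2 + couette_B R1 R2 \<omega>1 \<omega>2 * (1 / R2) = R2 * \<omega>2"
    using assms by (simp_all add: couette_A_eq couette_B_eq divide_simps) (simp_all add: algebra_simps power2_eq_square)
qed

text \<open>The factor \<open>R1 + R2\<close> of \<open>R2\<^sup>2 - R1\<^sup>2\<close> cancels.
  Both bounds are linear in \<open>C\<close>, so a small wall speed makes the whole Couette flow
  small.\<close>

lemma couette_coefficient_bounds:
  assumes R: "0 < R1" "R1 < R2" and \<omega>: "R1 * \<bar>\<omega>1\<bar> \<le> C" "R2 * \<bar>\<omega>2\<bar> \<le> C"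
  shows "\<bar>couette_A R1 R2 \<omega>1 \<omega>2\<bar> \<le> C / (R2 - R1)"
    and "\<bar>couette_B R1 R2 \<omega>1 \<omega>2\<bar> \<le> R1 * R2 * C / (R2 - R1)"
proof -
  have s: "R2\<^sup>2 - R1\<^sup>2 = (R2 - R1) * (R1 + R2)" by (simp add: power2_eq_square algebra_simps)
  have "\<bar>R2\<^sup>2 * \<omega>2 - R1\<^sup>2 * \<omega>1\<bar> \<le> R2 * (R2 * \<bar>\<omega>2\<bar>) + R1 * (R1 * \<bar>\<omega>1\<bar>)"
    using abs_triangle_ineq4[of "R2\<^sup>2 * \<omega>2" "R1\<^sup>2 * \<omega>1"] R by (simp add: abs_mult power2_eq_square mult.assoc)
  also have "\<dots> \<le> R2 * C + R1 * C" using R \<omega> by (intro add_mono mult_left_mono) auto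
  finally have "\<bar>R2\<^sup>2 * \<omega>2 - R1\<^sup>2 * \<omega>1\<bar> \<le> (R1 + R2) * C" by (simp add: algebra_simps)
  then show "\<bar>couette_A R1 R2 \<omega>1 \<omega>2\<bar> \<le> C / (R2 - R1)"
    using R unfolding couette_A_eq[OF R] s by (simp add: abs_divide abs_mult divide_simps mult_ac)
  have "\<bar>R1\<^sup>2 * R2\<^sup>2 * (\<omega>1 - \<omega>2)\<bar> = R1\<^sup>2 * R2\<^sup>2 * \<bar>\<omega>1 - \<omega>2\<bar>" by (simp add: abs_mult)
  also have "\<dots> \<le> R1\<^sup>2 * R2\<^sup>2 * (\<bar>\<omega>1\<bar> + \<bar>\<omega>2\<bar>)" by (intro mult_left_mono) auto
  also have "\<dots> = R1 * R2\<^sup>2 * (R1 * \<bar>\<omega>1\<bar>) + R1\<^sup>2 * R2 * (R2 * \<bar>\<omega>2\<bar>)"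
    by (simp add: power2_eq_square algebra_simps)
  also have "\<dots> \<le> R1 * R2\<^sup>2 * C + R1\<^sup>2 * R2 * C" using R \<omega> by (intro add_mono mult_left_mono) auto
  finally have "\<bar>R1\<^sup>2 * R2\<^sup>2 * (\<omega>1 - \<omega>2)\<bar> \<le> (R1 + R2) * (R1 * R2 * C)" by (simp add: algebra_simps power2_eq_square)
  then show "\<bar>couette_B R1 R2 \<omega>1 \<omega>2\<bar> \<le> R1 * R2 * C / (R2 - R1)"
    using R unfolding couette_B_eq[OF R] s by (simp add: abs_divide abs_mult divide_simps mult_ac)
qed

text \<open>\<open>r W'\<close> has derivative \<open>4 r / R1\<^sup>2\<close>, so integrating \<open>(r W W')'\<close> turns zero flux into
  \<open>\<integral> r W'\<^sup>2 = 0\<close>.\<close>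

lemma poiseuille_flux_nonzero:
  fixes \<kappa> :: real
  assumes R: "0 < R1" "R1 < R2"
    and W: "\<And>r. W r = (r / R1)\<^sup>2 - 1 + \<kappa> * ln (r / R1)" and bc: "W R1 = 0" "W R2 = 0"
  shows "integral {R1..R2} (\<lambda>r. r * W r) \<noteq> 0"
proof
  assume flux: "integral {R1..R2} (\<lambda>r. r * W r) = 0"
  let ?W' = "\<lambda>r. 2 * r / R1\<^sup>2 + \<kappa> / r"
  have dW: "(W has_real_derivative ?W' r) (at r)" if "r > 0" for r
  proof -
    have "((\<lambda>r. (r / R1)\<^sup>2 - 1 + \<kappa> * ln (r / R1)) has_real_derivative ?W' r) (at r)"
      using that R by (auto intro!: derivative_eq_intros simp: power2_eq_square)
    then show ?thesis by (simp add: W[abs_def])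
  qed
  have cW: "continuous_on {R1..R2} W"
    using R by (intro DERIV_continuous_on[where D = ?W']) (auto intro!: has_field_derivative_at_within dW)
  have "((\<lambda>r. 4 / R1\<^sup>2 * (r * W r) + r * (?W' r)\<^sup>2) has_integral (R2 * ?W' R2 * W R2 - R1 * ?W' R1 * W R1)) {R1..R2}"
  proof (rule fundamental_theorem_of_calculus)
    fix r assume "r \<in> {R1..R2}"
    then have r: "r > 0" using R by auto
    \<comment> \<open>For \<open>r > 0\<close> the product \<open>r * ?W' r\<close> equals this
      polynomial, which is easier to differentiate.\<close>
    have "((\<lambda>r. (2 * r\<^sup>2 / R1\<^sup>2 + \<kappa>) * W r) has_real_derivative 4 * r / R1\<^sup>2 * W r + (2 * r\<^sup>2 / R1\<^sup>2 + \<kappa>) * ?W' r) (at r)"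
      using DERIV_mult[OF DERIV_add[OF DERIV_cdivide[OF DERIV_cmult[OF DERIV_power[OF DERIV_ident, of 2], of 2], of "R1\<^sup>2"]
            DERIV_const[of \<kappa>]] dW[OF r]] by (simp add: mult_ac)
    then have "((\<lambda>r. r * ?W' r * W r) has_real_derivative 4 * r / R1\<^sup>2 * W r + (2 * r\<^sup>2 / R1\<^sup>2 + \<kappa>) * ?W' r) (at r)"
      by (rule has_field_derivative_transform_within_open[where S = "{0<..}"])
        (use r R in \<open>auto simp: field_simps power2_eq_square\<close>)
    moreover have "4 * r / R1\<^sup>2 * W r + (2 * r\<^sup>2 / R1\<^sup>2 + \<kappa>) * ?W' r = 4 / R1\<^sup>2 * (r * W r) + r * (?W' r)\<^sup>2"
      using r by (simp add: field_simps power2_eq_square)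
    ultimately show "((\<lambda>r. r * ?W' r * W r) has_vector_derivative 4 / R1\<^sup>2 * (r * W r) + r * (?W' r)\<^sup>2) (at r within {R1..R2})"
      by (simp add: has_real_derivative_iff_has_vector_derivative has_vector_derivative_at_within)
  qed (use R in auto)
  moreover have "((\<lambda>r. 4 / R1\<^sup>2 * (r * W r)) has_integral 4 / R1\<^sup>2 * 0) {R1..R2}"
    unfolding flux[symmetric]
    by (intro has_integral_mult_right integrable_integral integrable_continuous_interval continuous_intros cW)
  ultimately have "((\<lambda>r. 4 / R1\<^sup>2 * (r * W r) + r * (?W' r)\<^sup>2 - 4 / R1\<^sup>2 * (r * W r)) has_integral
      R2 * ?W' R2 * W R2 - R1 * ?W' R1 * W R1 - 4 / R1\<^sup>2 * 0) {R1..R2}"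
    by (rule has_integral_diff)
  then have int0: "integral {R1..R2} (\<lambda>r. r * (?W' r)\<^sup>2) = 0"
    using bc by (intro integral_unique) simp
  have "\<forall>r\<in>{R1..R2}. r * (?W' r)\<^sup>2 = 0"
    by (rule integral_eq_0_iff[THEN iffD1, OF _ _ _ int0]) (use R in \<open>auto intro!: continuous_intros\<close>)
  \<comment> \<open>The inner wall forces \<open>\<kappa> = - 2\<close>, and the outer wall then
    forces equal radii.\<close>
  then have "?W' R1 = 0" "?W' R2 = 0" using R by auto
  then have "\<kappa> = - 2" "R2\<^sup>2 * 2 = - \<kappa> * R1\<^sup>2" using R by (auto simp: field_simps power2_eq_square)
  then have "R2\<^sup>2 = R1\<^sup>2" by simp
  then show False using R by (simp add: power2_eq_iff)
qed

lemma strip_C1_couette: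
  assumes "0 < R1" and V: "\<And>r. V r = A * r + B * (1 / r)"
  shows "strip_C1 R1 R2 (\<lambda>r z. V r) (\<lambda>r z. A - B / r\<^sup>2) (\<lambda>r z. 0)"
    and "strip_C1 R1 R2 (\<lambda>r z. A - B / r\<^sup>2) (\<lambda>r z. 2 * B / r ^ 3) (\<lambda>r z. 0)"
proof -
  show "strip_C1 R1 R2 (\<lambda>r z. V r) (\<lambda>r z. A - B / r\<^sup>2) (\<lambda>r z. 0)"
  proof (rule strip_C1_radial)
    fix r assume "r \<in> {R1..R2}"
    then have "r > 0" using assms by auto
    then have "((\<lambda>r. A * r + B * inverse r) has_real_derivative A - B / r\<^sup>2) (at r within {R1..R2})"
      by (auto intro!: derivative_eq_intros simp: field_simps power2_eq_square)
    then show "(V has_real_derivative A - B / r\<^sup>2) (at r within {R1..R2})"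
      by (simp add: V[abs_def] inverse_eq_divide)
  qed (use assms in \<open>auto intro!: continuous_intros\<close>)
  show "strip_C1 R1 R2 (\<lambda>r z. A - B / r\<^sup>2) (\<lambda>r z. 2 * B / r ^ 3) (\<lambda>r z. 0)"
  proof (rule strip_C1_radial)
    fix r assume "r \<in> {R1..R2}"
    then have r: "r > 0" using assms by auto
    have "((\<lambda>r. A - B / r\<^sup>2) has_real_derivative 0 - (0 * r\<^sup>2 - B * (real 2 * (1 * r ^ (2 - Suc 0)))) / (r\<^sup>2 * r\<^sup>2)) (at r within {R1..R2})"
      by (rule DERIV_diff[OF DERIV_const DERIV_divide[OF DERIV_const DERIV_power[OF DERIV_ident]]]) (use r in simp)
    moreover have "0 - (0 * r\<^sup>2 - B * (real 2 * (1 * r ^ (2 - Suc 0)))) / (r\<^sup>2 * r\<^sup>2) = 2 * B / r ^ 3"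
      using r by (simp add: field_simps power2_eq_square power3_eq_cube)
    ultimately show "((\<lambda>r. A - B / r\<^sup>2) has_real_derivative 2 * B / r ^ 3) (at r within {R1..R2})"
      by (simp only:)
  qed (use assms in \<open>auto intro!: continuous_intros\<close>)
qed

lemma strip_C1_poiseuille:
  assumes "0 < R1" and W: "\<And>r. W r = (r / R1)\<^sup>2 - 1 + \<kappa> * ln (r / R1)"
  shows "strip_C1 R1 R2 (\<lambda>r z. k * W r) (\<lambda>r z. k * (2 * r / R1\<^sup>2 + \<kappa> / r)) (\<lambda>r z. 0)"
    and "strip_C1 R1 R2 (\<lambda>r z. k * (2 * r / R1\<^sup>2 + \<kappa> / r)) (\<lambda>r z. k * (2 / R1\<^sup>2 - \<kappa> / r\<^sup>2)) (\<lambda>r z. 0)"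
proof -
  show "strip_C1 R1 R2 (\<lambda>r z. k * W r) (\<lambda>r z. k * (2 * r / R1\<^sup>2 + \<kappa> / r)) (\<lambda>r z. 0)"
  proof (rule strip_C1_radial)
    fix r assume "r \<in> {R1..R2}"
    then have "r > 0" using assms by auto
    then show "((\<lambda>r. k * W r) has_real_derivative k * (2 * r / R1\<^sup>2 + \<kappa> / r)) (at r within {R1..R2})"
      using assms(1) unfolding W[abs_def]
      by (auto intro!: derivative_eq_intros simp: power2_eq_square)
  qed (use assms in \<open>auto intro!: continuous_intros\<close>)
  show "strip_C1 R1 R2 (\<lambda>r z. k * (2 * r / R1\<^sup>2 + \<kappa> / r)) (\<lambda>r z. k * (2 / R1\<^sup>2 - \<kappa> / r\<^sup>2)) (\<lambda>r z. 0)"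
  proof (rule strip_C1_radial)
    fix r assume "r \<in> {R1..R2}"
    then have "r > 0" using assms by auto
    then show "((\<lambda>r. k * (2 * r / R1\<^sup>2 + \<kappa> / r)) has_real_derivative k * (2 / R1\<^sup>2 - \<kappa> / r\<^sup>2)) (at r within {R1..R2})"
      using assms(1) by (auto intro!: derivative_eq_intros simp: power2_eq_square)
  qed (use assms in \<open>auto intro!: continuous_intros\<close>)
qed

text \<open>Centrifugal balance: expanding \<open>(V r)\<^sup>2 / r\<close> into
  \<open>A\<^sup>2 * r + 2 * A * B / r + B\<^sup>2 / r ^ 3\<close> and integrating term by term
  yields this pressure.\<close>

lemma strip_C1_couette_pressure:
  assumes "0 < R1" and V: "\<And>r. V r = A * r + B * (1 / r)"
  shows "strip_C1 R1 R2 (\<lambda>r z. A\<^sup>2 / 2 * r\<^sup>2 + 2 * A * B * ln r - B\<^sup>2 / 2 * (1 / r\<^sup>2)) (\<lambda>r z. (V r)\<^sup>2 / r) (\<lambda>r z. 0)"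
proof (rule strip_C1_radial)
  fix r assume "r \<in> {R1..R2}"
  then have r: "r > 0" using assms by auto
  have "((\<lambda>r. A\<^sup>2 / 2 * r\<^sup>2 + 2 * A * B * ln r - B\<^sup>2 / 2 * (1 / r\<^sup>2)) has_real_derivative
      A\<^sup>2 / 2 * (real 2 * (1 * r ^ (2 - Suc 0))) + 2 * A * B * (1 / r)
        - B\<^sup>2 / 2 * ((0 * r\<^sup>2 - 1 * (real 2 * (1 * r ^ (2 - Suc 0)))) / (r\<^sup>2 * r\<^sup>2))) (at r)"
    by (rule DERIV_diff[OF DERIV_add[OF DERIV_cmult[OF DERIV_power[OF DERIV_ident]] DERIV_cmult[OF DERIV_ln_divide]]
          DERIV_cmult[OF DERIV_divide[OF DERIV_const DERIV_power[OF DERIV_ident]]]]) (use r in simp)+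
  moreover have "A\<^sup>2 / 2 * (real 2 * (1 * r ^ (2 - Suc 0))) + 2 * A * B * (1 / r)
        - B\<^sup>2 / 2 * ((0 * r\<^sup>2 - 1 * (real 2 * (1 * r ^ (2 - Suc 0)))) / (r\<^sup>2 * r\<^sup>2)) = (V r)\<^sup>2 / r"
    using r by (simp add: V field_simps power2_eq_square power3_eq_cube)
  ultimately show "((\<lambda>r. A\<^sup>2 / 2 * r\<^sup>2 + 2 * A * B * ln r - B\<^sup>2 / 2 * (1 / r\<^sup>2)) has_real_derivative (V r)\<^sup>2 / r) (at r within {R1..R2})"
    by (simp only: has_field_derivative_at_within)
qed (use assms in \<open>auto simp: V intro!: continuous_intros\<close>)

subsection \<open>Rigidity\<close>

theorem theorem1p1:
  fixes \<nu> R1 R2 :: real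
  assumes "\<nu> > 0" and "0 < R1" and "R1 < R2"
  shows "\<exists>C1>0. \<forall>(\<omega>1::real) (\<omega>2::real)
      (vr :: real \<Rightarrow> real \<Rightarrow> real) (v\<theta> :: real \<Rightarrow> real \<Rightarrow> real)
      (vz :: real \<Rightarrow> real \<Rightarrow> real) (p :: real \<Rightarrow> real \<Rightarrow> real).
    smooth_upto_boundary R1 R2 vr \<and> smooth_upto_boundary R1 R2 v\<theta> \<and>
    smooth_upto_boundary R1 R2 vz \<and> smooth_upto_boundary R1 R2 p \<and>
    axisym_stationary_NS \<nu> R1 R2 vr v\<theta> vz p \<and>
    rotating_cylinder_bc R1 R2 \<omega>1 \<omega>2 vr v\<theta> vz \<and>
    max (R1 * \<bar>\<omega>1\<bar>) (R2 * \<bar>\<omega>2\<bar>) < C1 \<and>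
    Linfty_norm (cyl_domain R1 R2) (cyl_field vr v\<theta> vz) < ereal C1
    \<longrightarrow>
    (let \<eta> = \<eta>_ratio R1 R2; A = couette_A R1 R2 \<omega>1 \<omega>2; B = couette_B R1 R2 \<omega>1 \<omega>2 in
      \<exists>a b :: real.
        (\<forall>r\<in>{R1..R2}. \<forall>z.
            vr r z = 0
          \<and> v\<theta> r z = A * r + B * (1 / r)
          \<and> vz r z = a / (4 * \<nu>) * R1\<^sup>2 *
              ((r / R1)\<^sup>2 - 1 + (1 - \<eta>\<^sup>2) / (\<eta>\<^sup>2 * ln \<eta>) * ln (r / R1))
          \<and> p r z = a * z + b + A\<^sup>2 / 2 * r\<^sup>2 + 2 * A * B * ln r - B\<^sup>2 / 2 * (1 / r\<^sup>2))
        \<and> (bounded_in_z R1 R2 p \<or> periodic_in_z R1 R2 p \<longrightarrow>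
            a = 0 \<and>
            (\<forall>r\<in>{R1..R2}. \<forall>z. vr r z = 0 \<and> v\<theta> r z = A * r + B * (1 / r) \<and> vz r z = 0)))"
proof -
  \<comment> \<open>This \<open>\<kappa>\<close> is the logarithmic coefficient that makes the
    Poiseuille profile \<open>W\<close> vanish at \<open>R2\<close>, unlike the Poincare weight of
    the same name above. \<open>I\<close> is the axial flux of \<open>W\<close> up to the factor
    \<open>2 * pi\<close>.\<close>
  define \<kappa> where "\<kappa> = (1 - (R1 / R2)\<^sup>2) / ((R1 / R2)\<^sup>2 * ln (R1 / R2))"
  define W where "W r = (r / R1)\<^sup>2 - 1 + \<kappa> * ln (r / R1)" for r
  define I where "I = integral {R1..R2} (\<lambda>r. r * W r)"
  have R: "0 < R1" "R1 < R2" "0 < R2" and \<nu>: "\<nu> > 0" using assms by auto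
  have W1: "W R1 = 0" using R by (simp add: W_def)
  have W2: "W R2 = 0"
  proof -
    have "ln (R1 / R2) < 0" using R by simp
    moreover have "ln (R2 / R1) = - ln (R1 / R2)" using R by (simp add: ln_div)
    ultimately show ?thesis using R by (simp add: W_def \<kappa>_def field_simps)
  qed
  have I0: "I \<noteq> 0" unfolding I_def by (rule poiseuille_flux_nonzero[OF R(1,2) W_def W1 W2])
  note SW = strip_C1_poiseuille[OF R(1) W_def, of R2]
  define w1 where "w1 = 2 * R2 / R1\<^sup>2 + \<bar>\<kappa>\<bar> / R1"
  have w1: "\<bar>2 * r / R1\<^sup>2 + \<kappa> / r\<bar> \<le> w1" if "r \<in> {R1..R2}" for r
  proof -
    have "\<bar>2 * r / R1\<^sup>2\<bar> \<le> 2 * R2 / R1\<^sup>2" "\<bar>\<kappa> / r\<bar> \<le> \<bar>\<kappa>\<bar> / R1"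
      using that R by (auto simp: abs_divide intro!: divide_right_mono divide_left_mono)
    then show ?thesis unfolding w1_def by linarith
  qed
  \<comment> \<open>Exactly the right-hand side of the smallness condition in
    \<open>perturbation_vanishes\<close>.\<close>
  define c where "c = min (\<nu> * R1 / 2) (\<nu> * R1 / (4 * (R2 - R1)\<^sup>2) / 2) / 4"
  have c: "c > 0" using R \<nu> by (simp add: c_def)
  define \<epsilon> where "\<epsilon> = min 1 (c / (2 * R2 + 3))"
  have \<epsilon>: "0 < \<epsilon>" "\<epsilon> \<le> 1" "\<epsilon> * (2 * R2 + 3) \<le> c"
  proof -
    show "0 < \<epsilon>" "\<epsilon> \<le> 1" using c R by (simp_all add: \<epsilon>_def)
    have "\<epsilon> \<le> c / (2 * R2 + 3)" by (simp add: \<epsilon>_def)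
    then show "\<epsilon> * (2 * R2 + 3) \<le> c" using R by (simp add: pos_le_divide_eq)
  qed
  \<comment> \<open>\<open>s1 * C\<close>, \<open>s2 * C\<close> and \<open>s3 * C\<close> will
    bound the Couette profile, its derivative and the derivative of the Poiseuille part.
    \<open>C\<close> is chosen so that these and \<open>C\<close> itself add up to
    \<open>\<epsilon>\<close>; all of them depend on \<open>\<nu>\<close>, \<open>R1\<close>,
    \<open>R2\<close> alone.\<close>
  define s1 where "s1 = 2 * R2 / (R2 - R1)"
  define s2 where "s2 = (1 + R2 / R1) / (R2 - R1)"
  define s3 where "s3 = R2 * (R2 - R1) / \<bar>I\<bar> * w1"
  have s: "0 \<le> s1" "0 \<le> s2" "0 \<le> s3"
    using R by (auto simp: s1_def s2_def s3_def w1_def intro!: mult_nonneg_nonneg divide_nonneg_nonneg add_nonneg_nonneg)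
  define C where "C = \<epsilon> / (1 + s1 + s2 + s3)"
  have C: "C > 0" using \<epsilon> s by (simp add: C_def)
  have C\<epsilon>: "C + s1 * C + s2 * C + s3 * C = \<epsilon>"
  proof -
    have "C * (1 + s1 + s2 + s3) = \<epsilon>" using s by (simp add: C_def)
    then show ?thesis by (simp add: algebra_simps)
  qed
  have sC: "0 \<le> s1 * C" "0 \<le> s2 * C" "0 \<le> s3 * C" using s C by simp_all
  show ?thesis
    unfolding Let_def \<eta>_ratio_def
  proof (rule exI[of _ C], intro conjI allI impI C, elim conjE)
    fix \<omega>1 \<omega>2 :: real and vr v\<theta> vz p :: "real \<Rightarrow> real \<Rightarrow> real"
    assume smooth: "smooth_upto_boundary R1 R2 vr" "smooth_upto_boundary R1 R2 v\<theta>"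
        "smooth_upto_boundary R1 R2 vz" "smooth_upto_boundary R1 R2 p"
      and NS: "axisym_stationary_NS \<nu> R1 R2 vr v\<theta> vz p"
      and bc: "rotating_cylinder_bc R1 R2 \<omega>1 \<omega>2 vr v\<theta> vz"
      and \<omega>: "max (R1 * \<bar>\<omega>1\<bar>) (R2 * \<bar>\<omega>2\<bar>) < C"
      and Linf: "Linfty_norm (cyl_domain R1 R2) (cyl_field vr v\<theta> vz) < ereal C"
    define A where "A = couette_A R1 R2 \<omega>1 \<omega>2"
    define B where "B = couette_B R1 R2 \<omega>1 \<omega>2"
    define V where "V r = A * r + B * (1 / r)" for r
    obtain fr fz frr frz fzr fzz where f: "strip_C1 R1 R2 vr fr fz" "strip_C1 R1 R2 fr frr frz" "strip_C1 R1 R2 fz fzr fzz"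
      using smooth(1) by (rule smooth_obtain_partials)
    obtain gr gz grr grz gzr gzz where g: "strip_C1 R1 R2 v\<theta> gr gz" "strip_C1 R1 R2 gr grr grz" "strip_C1 R1 R2 gz gzr gzz"
      using smooth(2) by (rule smooth_obtain_partials)
    obtain hr hz hrr hrz hzr hzz where h: "strip_C1 R1 R2 vz hr hz" "strip_C1 R1 R2 hr hrr hrz" "strip_C1 R1 R2 hz hzr hzz"
      using smooth(3) by (rule smooth_obtain_partials)
    obtain pr pz prr prz pzr pzz where p: "strip_C1 R1 R2 p pr pz" "strip_C1 R1 R2 pr prr prz" "strip_C1 R1 R2 pz pzr pzz"
      using smooth(4) by (rule smooth_obtain_partials)
    have NS': "vr r z * fr r z + vz r z * fz r z - (v\<theta> r z)\<^sup>2 / r + pr r z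
         = \<nu> * (frr r z + 1 / r * fr r z + fzz r z - 1 / r\<^sup>2 * vr r z)
      \<and> vr r z * gr r z + vz r z * gz r z + vr r z * v\<theta> r z / r
         = \<nu> * (grr r z + 1 / r * gr r z + gzz r z - 1 / r\<^sup>2 * v\<theta> r z)
      \<and> vr r z * hr r z + vz r z * hz r z + pz r z
         = \<nu> * (hrr r z + 1 / r * hr r z + hzz r z)
      \<and> vr r z + r * fr r z + r * hz r z = 0" if r: "r \<in> {R1<..<R2}" for r z
    proof -
      have "d_r (\<lambda>s \<zeta>. s * vr s \<zeta>) r z = vr r z + r * fr r z"
        unfolding d_r_def
        by (rule DERIV_imp_deriv)
          (use DERIV_mult[OF DERIV_ident strip_C1_has_derivative_interior[OF f(1) r, of z]] in \<open>simp add: mult.commute\<close>)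
      moreover have "r \<noteq> 0" using r R by auto
      ultimately show ?thesis
        using NS[unfolded axisym_stationary_NS_def, rule_format, OF r, of z]
        unfolding strip_C1_laplace_cyl[OF f r] strip_C1_laplace_cyl[OF g r] strip_C1_laplace_cyl[OF h r]
          strip_C1_d_r[OF f(1) r] strip_C1_d_r[OF g(1) r] strip_C1_d_r[OF h(1) r] strip_C1_d_r[OF p(1) r]
          strip_C1_d_z[OF f(1) r] strip_C1_d_z[OF g(1) r] strip_C1_d_z[OF h(1) r] strip_C1_d_z[OF p(1) r]
        by (simp add: field_simps)
    qed
    note bc' = bc[unfolded rotating_cylinder_bc_def, rule_format]
    have V12: "V R1 = R1 * \<omega>1" "V R2 = R2 * \<omega>2"
      unfolding V_def A_def B_def using couette_boundary_values[OF R(1,2)] by blast+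
    \<comment> \<open>The norm bound covers interior radii; on the walls the boundary values and the
      bound on wall speeds take over.\<close>
    have bound: "\<bar>vr r z\<bar> \<le> C" "\<bar>v\<theta> r z\<bar> \<le> C" "\<bar>vz r z\<bar> \<le> C" if r: "r \<in> {R1..R2}" for r z
    proof -
      have "\<bar>vr r z\<bar> \<le> C \<and> \<bar>v\<theta> r z\<bar> \<le> C \<and> \<bar>vz r z\<bar> \<le> C"
      proof (cases "r = R1 \<or> r = R2")
        case True
        then show ?thesis using bc'[of z] \<omega> R C by (auto simp: abs_mult)
      next
        case False
        then have "r \<in> {R1<..<R2}" using r by auto
        then show ?thesis
          using Linfty_norm_less_imp_bounded[OF _ strip_C1_continuous_on(1)[OF f(1)]
              strip_C1_continuous_on(1)[OF g(1)] strip_C1_continuous_on(1)[OF h(1)] Linf] R by simp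
      qed
      then show "\<bar>vr r z\<bar> \<le> C" "\<bar>v\<theta> r z\<bar> \<le> C" "\<bar>vz r z\<bar> \<le> C" by auto
    qed
    have AB: "\<bar>A\<bar> \<le> C / (R2 - R1)" "\<bar>B\<bar> \<le> R1 * R2 * C / (R2 - R1)"
      unfolding A_def B_def using couette_coefficient_bounds[OF R(1,2), of \<omega>1 C \<omega>2] \<omega> by simp_all
    have V: "\<bar>V r\<bar> \<le> s1 * C" "\<bar>A - B / r\<^sup>2\<bar> \<le> s2 * C" if r: "r \<in> {R1..R2}" for r
    proof -
      define d where "d = R2 - R1"
      have d: "d > 0" using R by (simp add: d_def)
      have rp: "r > 0" "R1 \<le> r" "r \<le> R2" using r R by auto
      have "\<bar>A\<bar> * r \<le> C / (R2 - R1) * R2" using AB(1) rp R C by (intro mult_mono) auto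
      moreover have "\<bar>B\<bar> / r \<le> (R1 * R2 * C / (R2 - R1)) / R1" using AB(2) rp R C by (intro frac_le) auto
      moreover have "C / (R2 - R1) * R2 + (R1 * R2 * C / (R2 - R1)) / R1 = s1 * C"
        unfolding s1_def d_def[symmetric] using R d by (simp add: field_simps)
      moreover have "\<bar>V r\<bar> \<le> \<bar>A\<bar> * r + \<bar>B\<bar> / r"
        unfolding V_def using abs_triangle_ineq[of "A * r" "B * (1 / r)"] rp by (simp add: abs_mult)
      ultimately show "\<bar>V r\<bar> \<le> s1 * C" by linarith
      have "R1\<^sup>2 \<le> r\<^sup>2" using rp R by (intro power_mono) auto
      then have "\<bar>B\<bar> / r\<^sup>2 \<le> (R1 * R2 * C / (R2 - R1)) / R1\<^sup>2" using AB(2) R C by (intro frac_le) auto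
      moreover have "C / (R2 - R1) + (R1 * R2 * C / (R2 - R1)) / R1\<^sup>2 = s2 * C"
        unfolding s2_def d_def[symmetric] using R d by (simp add: field_simps power2_eq_square)
      moreover have "\<bar>A - B / r\<^sup>2\<bar> \<le> \<bar>A\<bar> + \<bar>B\<bar> / r\<^sup>2"
        using abs_triangle_ineq4[of A "B / r\<^sup>2"] by (simp add: abs_divide)
      ultimately show "\<bar>A - B / r\<^sup>2\<bar> \<le> s2 * C" using AB(1) by linarith
    qed
    have cz: "continuous_on {R1..R2} (\<lambda>r. r * vz r z)" for z
      by (intro continuous_intros strip_continuous_on_slice[OF strip_C1_continuous_on(1)[OF h(1)] order_refl])
    have cW: "continuous_on {R1..R2} (\<lambda>r. r * W r)"
      using strip_continuous_on_slice[OF strip_C1_continuous_on(1)[OF SW(1)[of 1]] order_refl]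
      by (intro continuous_intros) simp
    \<comment> \<open>Amplitude for which \<open>k * W\<close> carries the axial flux that
      \<open>vz\<close> has at \<open>z = 0\<close>; incompressibility makes this flux the same at
      every height.\<close>
    define k where "k = integral {R1..R2} (\<lambda>r. r * vz r 0) / I"
    have k: "\<bar>k\<bar> * w1 \<le> s3 * C"
    proof -
      have "norm (integral {R1..R2} (\<lambda>r. r * vz r 0)) \<le> (R2 * C) * (R2 - R1)"
      proof (rule integral_bound)
        show "norm (r * vz r 0) \<le> R2 * C" if "r \<in> {R1..R2}" for r
          using bound(3)[OF that, of 0] that R by (auto simp: abs_mult intro!: mult_mono)
      qed (use R cz in auto)
      then have "\<bar>k\<bar> \<le> (R2 * C) * (R2 - R1) / \<bar>I\<bar>"
        unfolding k_def abs_divide by (intro divide_right_mono) auto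
      moreover have "0 \<le> w1" using R by (simp add: w1_def)
      ultimately have "\<bar>k\<bar> * w1 \<le> (R2 * C) * (R2 - R1) / \<bar>I\<bar> * w1" by (rule mult_right_mono)
      also have "\<dots> = s3 * C" by (simp add: s3_def)
      finally show ?thesis .
    qed
    \<comment> \<open>The pressure gradient driving \<open>k * W\<close>, since
      \<open>W'' + W' / r = 4 / R1\<^sup>2\<close>.\<close>
    define a where "a = k * \<nu> * 4 / R1\<^sup>2"
    define \<Phi> where "\<Phi> r = A\<^sup>2 / 2 * r\<^sup>2 + 2 * A * B * ln r - B\<^sup>2 / 2 * (1 / r\<^sup>2)" for r
    note SV = strip_C1_couette[OF R(1) V_def, of R2]
    \<comment> \<open>Zero partials of the subtracted profiles stay visible as \<open>- 0\<close>,
      which is why \<open>e1\<close> to \<open>e4\<close> below are written with them.\<close>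
    note G = strip_C1_diff[OF g(1) SV(1)] strip_C1_diff[OF g(2) SV(2)] strip_C1_diff[OF g(3) strip_C1_const]
    note H = strip_C1_diff[OF h(1) SW(1)[of k]] strip_C1_diff[OF h(2) SW(2)[of k]] strip_C1_diff[OF h(3) strip_C1_const]
    note Q = strip_C1_diff[OF strip_C1_diff[OF p(1) strip_C1_axial[where a = a]]
        strip_C1_couette_pressure[OF R(1) V_def, of R2, folded \<Phi>_def]]
    define \<psi> where "\<psi> r z = integral {R1..r} (\<lambda>s. s * (vz s z - k * W s))" for r z
    have \<psi>: "strip_C1 R1 R2 \<psi> (\<lambda>r z. r * (vz r z - k * W r)) (\<lambda>r z. - (r * vr r z))"
      unfolding \<psi>_def[abs_def] using NS' bc' by (intro stream_function[OF f(1) H(1)]) auto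
    have \<psi>1: "\<psi> R1 z = 0" for z by (simp add: \<psi>_def)
    \<comment> \<open>At the outer wall the axial derivative of \<open>\<psi>\<close> is
      \<open>- (R2 * vr R2 z) = 0\<close>, and at \<open>z = 0\<close> the choice of
      \<open>k\<close> makes the flux of \<open>vz - k * W\<close> vanish.\<close>
    have \<psi>2: "\<psi> R2 z = 0" for z
    proof -
      have "\<forall>z. ((\<lambda>z. \<psi> R2 z) has_real_derivative 0) (at z)"
        using strip_C1_has_derivative(2)[OF \<psi>, of R2] bc' R by auto
      then have "\<psi> R2 z = \<psi> R2 0" by (rule DERIV_isconst_all)
      also have "\<psi> R2 0 = integral {R1..R2} (\<lambda>r. r * vz r 0) - k * I"
      proof -
        have "((\<lambda>r. r * vz r 0 - k * (r * W r)) has_integral integral {R1..R2} (\<lambda>r. r * vz r 0) - k * I) {R1..R2}"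
          unfolding I_def
          by (intro has_integral_diff has_integral_mult_right integrable_integral integrable_continuous_interval cz cW)
        then show ?thesis
          unfolding \<psi>_def by (intro integral_unique) (simp add: algebra_simps)
      qed
      also have "\<dots> = 0" using I0 by (simp add: k_def)
      finally show ?thesis .
    qed
    obtain Wb where Wb: "\<And>r. r \<in> {R1..R2} \<Longrightarrow> \<bar>W r\<bar> \<le> Wb"
    proof -
      have "compact (W ` {R1..R2})"
        using strip_continuous_on_slice[OF strip_C1_continuous_on(1)[OF SW(1)[of 1]] order_refl]
        by (intro compact_continuous_image) auto
      then have "bounded (W ` {R1..R2})" by (rule compact_imp_bounded)
      then obtain b where "\<forall>x\<in>W ` {R1..R2}. norm x \<le> b" by (auto simp: bounded_iff)
      then show thesis by (intro that) auto
    qed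
    define Hb where "Hb = C + \<bar>k\<bar> * Wb"
    have Hb: "\<bar>vz r z - k * W r\<bar> \<le> Hb" if "r \<in> {R1..R2}" for r z
    proof -
      have "\<bar>k\<bar> * \<bar>W r\<bar> \<le> \<bar>k\<bar> * Wb" using Wb[OF that] by (intro mult_left_mono) auto
      then show ?thesis
        unfolding Hb_def using bound(3)[OF that, of z] abs_triangle_ineq4[of "vz r z" "k * W r"] by (simp add: abs_mult)
    qed
    have Hb0: "0 \<le> Hb" using Hb[of R1 0] R by force
    \<comment> \<open>Any common bound for \<open>u\<close> and \<open>\<psi>\<close> will do; it
      may depend on the solution.\<close>
    define M where "M = \<epsilon> + Hb + (R2 * Hb) * (R2 - R1)"
    have M: "\<epsilon> \<le> M" "Hb \<le> M" "(R2 * Hb) * (R2 - R1) \<le> M"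
      using \<epsilon> Hb0 R by (auto simp: M_def)
    have \<psi>b: "\<bar>\<psi> r z\<bar> \<le> M" if r: "r \<in> {R1..R2}" for r z
    proof -
      have "norm (\<psi> r z) \<le> (R2 * Hb) * (r - R1)"
        unfolding \<psi>_def
      proof (rule integral_bound)
        show "continuous_on {R1..r} (\<lambda>s. s * (vz s z - k * W s))"
          using r by (intro continuous_intros strip_continuous_on_slice[OF strip_C1_continuous_on(1)[OF H(1)]]) auto
        show "norm (s * (vz s z - k * W s)) \<le> R2 * Hb" if "s \<in> {R1..r}" for s
          using Hb[of s z] that r R by (auto simp: abs_mult intro!: mult_mono)
      qed (use r in auto)
      also have "\<dots> \<le> (R2 * Hb) * (R2 - R1)" using r R Hb0 by (intro mult_left_mono) auto
      finally show ?thesis using M by simp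
    qed
    have small: "\<bar>vr r z\<bar> \<le> \<epsilon>" "\<bar>v\<theta> r z - V r\<bar> \<le> \<epsilon>" "\<bar>vz r z\<bar> \<le> \<epsilon>" "\<bar>V r\<bar> \<le> \<epsilon>"
        "\<bar>A - B / r\<^sup>2\<bar> \<le> \<epsilon>" "\<bar>k * (2 * r / R1\<^sup>2 + \<kappa> / r)\<bar> \<le> \<epsilon>" if r: "r \<in> {R1..R2}" for r z
    proof -
      have "\<bar>k\<bar> * \<bar>2 * r / R1\<^sup>2 + \<kappa> / r\<bar> \<le> \<bar>k\<bar> * w1" using w1[OF r] by (intro mult_left_mono) auto
      then have "\<bar>k * (2 * r / R1\<^sup>2 + \<kappa> / r)\<bar> \<le> s3 * C" using k by (simp add: abs_mult)
      then show "\<bar>vr r z\<bar> \<le> \<epsilon>" "\<bar>v\<theta> r z - V r\<bar> \<le> \<epsilon>" "\<bar>vz r z\<bar> \<le> \<epsilon>" "\<bar>V r\<bar> \<le> \<epsilon>"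
        "\<bar>A - B / r\<^sup>2\<bar> \<le> \<epsilon>" "\<bar>k * (2 * r / R1\<^sup>2 + \<kappa> / r)\<bar> \<le> \<epsilon>"
        using bound[OF r, of z] V[OF r] C\<epsilon> C sC by linarith+
    qed
    \<comment> \<open>The square of \<open>V + (v\<theta> - V)\<close> is expanded; its part
      \<open>V\<^sup>2 / r\<close> is taken up by the Couette pressure.\<close>
    have e1: "vr r z * fr r z + vz r z * fz r z - (2 * V r * (v\<theta> r z - V r) + (v\<theta> r z - V r)\<^sup>2) / r + (pr r z - 0 - (V r)\<^sup>2 / r)
        = \<nu> * (frr r z + fr r z / r + fzz r z - vr r z / r\<^sup>2)" if r: "r \<in> {R1<..<R2}" for r z
    proof -
      have "(2 * V r * (v\<theta> r z - V r) + (v\<theta> r z - V r)\<^sup>2) / r + (V r)\<^sup>2 / r = (v\<theta> r z)\<^sup>2 / r"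
        by (simp add: power2_eq_square algebra_simps flip: add_divide_distrib)
      then show ?thesis using NS'[OF r, of z] by simp
    qed
    \<comment> \<open>The Couette profile satisfies \<open>V'' + V' / r - V / r\<^sup>2 = 0\<close>,
      so it drops out of the viscous term.\<close>
    have e2: "vr r z * (gr r z - (A - B / r\<^sup>2) + (A - B / r\<^sup>2)) + vz r z * (gz r z - 0) + vr r z * (v\<theta> r z - V r + V r) / r
        = \<nu> * (grr r z - 2 * B / r ^ 3 + (gr r z - (A - B / r\<^sup>2)) / r + (gzz r z - 0) - (v\<theta> r z - V r) / r\<^sup>2)"
      if r: "r \<in> {R1<..<R2}" for r z
    proof -
      have "grr r z - 2 * B / r ^ 3 + (gr r z - (A - B / r\<^sup>2)) / r + (gzz r z - 0) - (v\<theta> r z - V r) / r\<^sup>2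
          = grr r z + 1 / r * gr r z + gzz r z - 1 / r\<^sup>2 * v\<theta> r z"
        using r R by (simp add: V_def field_simps power2_eq_square power3_eq_cube)
      then show ?thesis using NS'[OF r, of z] by simp
    qed
    have e3: "vr r z * (hr r z - k * (2 * r / R1\<^sup>2 + \<kappa> / r) + k * (2 * r / R1\<^sup>2 + \<kappa> / r)) + vz r z * (hz r z - 0) + (pz r z - a - 0)
        = \<nu> * (hrr r z - k * (2 / R1\<^sup>2 - \<kappa> / r\<^sup>2) + (hr r z - k * (2 * r / R1\<^sup>2 + \<kappa> / r)) / r + (hzz r z - 0))"
      if r: "r \<in> {R1<..<R2}" for r z
    proof -
      have "\<nu> * (hrr r z - k * (2 / R1\<^sup>2 - \<kappa> / r\<^sup>2) + (hr r z - k * (2 * r / R1\<^sup>2 + \<kappa> / r)) / r + (hzz r z - 0))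
          = \<nu> * (hrr r z + 1 / r * hr r z + hzz r z) - a"
        using r R by (simp add: a_def field_simps power2_eq_square)
      then show ?thesis using NS'[OF r, of z] by simp
    qed
    have e4: "vr r z + r * fr r z + r * (hz r z - 0) = 0" if "r \<in> {R1<..<R2}" for r z
      using NS'[OF that, of z] by simp
    have zero: "vr r z = 0 \<and> v\<theta> r z - V r = 0 \<and> vz r z - k * W r = 0" if "r \<in> {R1..R2}" for r z
    proof (rule perturbation_vanishes[OF R(1,2) \<nu> f G H \<psi> Q _ e1 e2 e3 e4 \<epsilon>(2) \<epsilon>(3)[unfolded c_def] _ _ _ _ _ _ _ _ _ _ that])
      show "vr r z = 0 \<and> v\<theta> r z - V r = 0 \<and> vz r z - k * W r = 0 \<and> \<psi> r z = 0" if "r \<in> {R1, R2}" for r z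
        using that bc'[of z] V12 W1 W2 \<psi>1 \<psi>2 by auto
      fix r z assume "r \<in> {R1<..<R2}"
      then have r: "r \<in> {R1..R2}" by auto
      show "\<bar>vr r z\<bar> \<le> \<epsilon>" "\<bar>v\<theta> r z - V r\<bar> \<le> \<epsilon>" "\<bar>vz r z\<bar> \<le> \<epsilon>" "\<bar>V r\<bar> \<le> \<epsilon>"
        "\<bar>A - B / r\<^sup>2\<bar> \<le> \<epsilon>" "\<bar>k * (2 * r / R1\<^sup>2 + \<kappa> / r)\<bar> \<le> \<epsilon>" by (rule small[OF r])+
      then show "\<bar>vr r z\<bar> \<le> M" "\<bar>v\<theta> r z - V r\<bar> \<le> M" using M by linarith+
      show "\<bar>vz r z - k * W r\<bar> \<le> M" using Hb[OF r, of z] M by linarith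
      show "\<bar>\<psi> r z\<bar> \<le> M" by (rule \<psi>b[OF r])
    qed
    define q where "q r z = p r z - a * z - \<Phi> r" for r z
    have int: "r \<in> {R1..R2}" if "r \<in> {R1<..<R2}" for r using that by auto
    note zf = strip_C1_vanishing[OF f(1)] and zg = strip_C1_vanishing[OF G(1)] and zh = strip_C1_vanishing[OF H(1)]
    have fr0: "fr r z = 0" and fz0: "fz r z = 0" if "r \<in> {R1<..<R2}" for r z
      using zf[OF _ that] zero int by blast+
    have frr0: "frr r z = 0" and fzz0: "fzz r z = 0" if "r \<in> {R1<..<R2}" for r z
      using strip_C1_vanishing(1)[OF f(2) fr0 that] strip_C1_vanishing(2)[OF f(3) fz0 that] by blast+
    have hr0: "hr r z - k * (2 * r / R1\<^sup>2 + \<kappa> / r) = 0" and hz0: "hz r z - 0 = 0" if "r \<in> {R1<..<R2}" for r z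
      using zh[OF _ that] zero int by blast+
    have hrr0: "hrr r z - k * (2 / R1\<^sup>2 - \<kappa> / r\<^sup>2) = 0" and hzz0: "hzz r z - 0 = 0" if "r \<in> {R1<..<R2}" for r z
      using strip_C1_vanishing(1)[OF H(2) hr0 that] strip_C1_vanishing(2)[OF H(3) hz0 that] by blast+
    \<comment> \<open>With \<open>u = 0\<close>, the perturbation equations say that the remaining
      pressure has zero gradient.\<close>
    have qr0: "pr r z - 0 - (V r)\<^sup>2 / r = 0" and qz0: "pz r z - a - 0 = 0" if r: "r \<in> {R1<..<R2}" for r z
      using e1[OF r, of z] e3[OF r, of z] zero[OF int[OF r], of z]
      unfolding fr0[OF r] fz0[OF r] frr0[OF r] fzz0[OF r] hr0[OF r] hz0[OF r] hrr0[OF r] hzz0[OF r]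
      by simp_all
    \<comment> \<open>Vanishing of the axial derivative is known only inside the gap, so constancy
      in \<open>z\<close> is shown at this radius and carried to all others by constancy in
      \<open>r\<close>. The value \<open>q r0 0\<close> becomes the constant
      \<open>b\<close>.\<close>
    define r0 where "r0 = (R1 + R2) / 2"
    have r0: "r0 \<in> {R1<..<R2}" using R by (auto simp: r0_def)
    have qr: "q r z = q R1 z" if "r \<in> {R1..R2}" for r z
    proof (rule DERIV_isconst2[OF R(2)])
      show "continuous_on {R1..R2} (\<lambda>r. q r z)"
        unfolding q_def by (rule strip_continuous_on_slice[OF strip_C1_continuous_on(1)[OF Q] order_refl])
      fix r assume "R1 < r" "r < R2"
      then have r: "r \<in> {R1<..<R2}" by auto
      show "((\<lambda>r. q r z) has_real_derivative 0) (at r)"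
        unfolding q_def using strip_C1_has_derivative_interior[OF Q r, of z] qr0[OF r] by simp
    qed (use that in auto)
    have "\<forall>z. (q r0 has_real_derivative 0) (at z)"
      unfolding q_def[abs_def] using strip_C1_has_derivative(2)[OF Q int[OF r0]] qz0[OF r0] by simp
    then have qz: "q r0 z = q r0 0" for z by (rule DERIV_isconst_all)
    have qb: "q r z = q r0 0" if "r \<in> {R1..R2}" for r z
      by (rule trans[OF qr[OF that] trans[OF qr[OF int[OF r0], symmetric] qz]])
    have vz_eq: "k * W r = a / (4 * \<nu>) * R1\<^sup>2 * ((r / R1)\<^sup>2 - 1 + (1 - (R1 / R2)\<^sup>2) / ((R1 / R2)\<^sup>2 * ln (R1 / R2)) * ln (r / R1))" for r
      using \<nu> R by (simp add: a_def W_def \<kappa>_def)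
    have p_eq: "p r z = a * z + q r0 0 + \<Phi> r" if "r \<in> {R1..R2}" for r z
      using qb[OF that, of z] by (simp add: q_def)
    have a0: "a = 0" if "bounded_in_z R1 R2 p \<or> periodic_in_z R1 R2 p"
      using that
    proof
      assume "bounded_in_z R1 R2 p"
      then obtain b where b: "\<And>z. \<bar>p r0 z\<bar> \<le> b"
        using r0 unfolding bounded_in_z_def bounded_iff by force
      show "a = 0"
      proof (rule ccontr)
        assume a: "a \<noteq> 0"
        \<comment> \<open>At this height the pressure differs from its value at 0 by
          \<open>2 * b + 1\<close>, more than the bound \<open>b\<close> allows.\<close>
        define z where "z = (2 * b + 1) / a"
        have "p r0 z - p r0 0 = 2 * b + 1" using p_eq[OF int[OF r0]] a by (simp add: z_def)
        then show False using b[of z] b[of 0] by linarith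
      qed
    next
      assume "periodic_in_z R1 R2 p"
      then obtain L where "L > 0" "p r0 (0 + L) = p r0 0" using r0 unfolding periodic_in_z_def by blast
      then show "a = 0" using p_eq[OF int[OF r0]] by simp
    qed
    have main: "\<forall>r\<in>{R1..R2}. \<forall>z. vr r z = 0 \<and> v\<theta> r z = A * r + B * (1 / r)
        \<and> vz r z = a / (4 * \<nu>) * R1\<^sup>2 * ((r / R1)\<^sup>2 - 1 + (1 - (R1 / R2)\<^sup>2) / ((R1 / R2)\<^sup>2 * ln (R1 / R2)) * ln (r / R1))
        \<and> p r z = a * z + q r0 0 + A\<^sup>2 / 2 * r\<^sup>2 + 2 * A * B * ln r - B\<^sup>2 / 2 * (1 / r\<^sup>2)"
      unfolding vz_eq[symmetric] using zero p_eq by (auto simp: V_def \<Phi>_def)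
    show "\<exists>a b. (\<forall>r\<in>{R1..R2}. \<forall>z. vr r z = 0
          \<and> v\<theta> r z = couette_A R1 R2 \<omega>1 \<omega>2 * r + couette_B R1 R2 \<omega>1 \<omega>2 * (1 / r)
          \<and> vz r z = a / (4 * \<nu>) * R1\<^sup>2 *
              ((r / R1)\<^sup>2 - 1 + (1 - (R1 / R2)\<^sup>2) / ((R1 / R2)\<^sup>2 * ln (R1 / R2)) * ln (r / R1))
          \<and> p r z = a * z + b + (couette_A R1 R2 \<omega>1 \<omega>2)\<^sup>2 / 2 * r\<^sup>2
              + 2 * couette_A R1 R2 \<omega>1 \<omega>2 * couette_B R1 R2 \<omega>1 \<omega>2 * ln r
              - (couette_B R1 R2 \<omega>1 \<omega>2)\<^sup>2 / 2 * (1 / r\<^sup>2))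
        \<and> (bounded_in_z R1 R2 p \<or> periodic_in_z R1 R2 p \<longrightarrow>
            a = 0 \<and>
            (\<forall>r\<in>{R1..R2}. \<forall>z. vr r z = 0
              \<and> v\<theta> r z = couette_A R1 R2 \<omega>1 \<omega>2 * r + couette_B R1 R2 \<omega>1 \<omega>2 * (1 / r) \<and> vz r z = 0))"
      unfolding A_def[symmetric] B_def[symmetric]
    proof (rule exI[of _ a], rule exI[of _ "q r0 0"], intro conjI impI)
      show "\<forall>r\<in>{R1..R2}. \<forall>z. vr r z = 0 \<and> v\<theta> r z = A * r + B * (1 / r) \<and> vz r z = 0"
        if "bounded_in_z R1 R2 p \<or> periodic_in_z R1 R2 p"
        using main a0[OF that] by simp
    qed (rule main, erule a0)
  qed
qed

end
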